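(* Let $\Omega\subset\mathbb{R}^N$ be a bounded domain, let $f$ satisfy (f1) and (f3), and let $u$ be the solution of $\inf\{\mathcal{I}_\Omega(v): v\in W^{1,\infty}_0(\Omega)\}$. Then $u\equiv0$ if and only if $f'(0)\,h(\Omega)\ge1$.
   Context: $\mathcal{I}_\Omega(v)=\int_\Omega [f(|Dv|)-v]\,dx$. The Cheeger constant of $\Omega$ is $h(\Omega)=\inf\Big\{\frac{\int_\Omega|D\phi|\,dx}{\int_\Omega|\phi|\,dx}:\ \phi\in C^1_0(\Omega),\ \phi\not\equiv0\Big\}$. (f1) $f\in C^1([0,\infty))$ is convex, monotone nondecreasing, $f(0)=0$ and $\lim_{s\to\infty}f(s)/s=+\infty$; (f3) $f'(0)>0$, $f\in C^{2,\alpha}(0,\infty)$ for some $0<\alpha<1$, and $f''(s)>0$ for every $s>0$. *)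

theory Defs
  imports "HOL-Analysis.Analysis"
begin

text \<open>Gradient of a real-valued function at a point (the vector g with
  Dv(x) h = g . h), chosen when v is differentiable at x.  For Lipschitz
  functions this is the a.e. gradient (Rademacher).\<close>
definition grad :: "('a::euclidean_space \<Rightarrow> real) \<Rightarrow> 'a \<Rightarrow> 'a" where
  "grad v x = (SOME g. (v has_derivative (\<lambda>h. g \<bullet> h)) (at x))"

definition domain :: "'a::euclidean_space set \<Rightarrow> bool" where
  "domain \<Omega> \<longleftrightarrow> open \<Omega> \<and> connected \<Omega> \<and> \<Omega> \<noteq> {}"

text \<open>W^{1,infinity}_0(Omega): Lipschitz functions vanishing outside Omega
  (functions on Omega extended by zero).\<close>
definition W1inf0 :: "'a::euclidean_space set \<Rightarrow> ('a \<Rightarrow> real) set" where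
  "W1inf0 \<Omega> = {v. (\<exists>C. C-lipschitz_on UNIV v) \<and> (\<forall>x. x \<notin> \<Omega> \<longrightarrow> v x = 0)}"

definition I_fun :: "(real \<Rightarrow> real) \<Rightarrow> 'a::euclidean_space set \<Rightarrow> ('a \<Rightarrow> real) \<Rightarrow> real" where
  "I_fun f \<Omega> v = (LINT x:\<Omega>|lebesgue. f (norm (grad v x)) - v x)"

definition C1_0 :: "'a::euclidean_space set \<Rightarrow> ('a \<Rightarrow> real) set" where
  "C1_0 \<Omega> = {\<phi>. (\<exists>g. continuous_on UNIV g \<and>
                     (\<forall>x. (\<phi> has_derivative (\<lambda>h. g x \<bullet> h)) (at x))) \<and>
                  compact (closure {x. \<phi> x \<noteq> 0}) \<and> closure {x. \<phi> x \<noteq> 0} \<subseteq> \<Omega>}"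

definition cheeger :: "'a::euclidean_space set \<Rightarrow> real" where
  "cheeger \<Omega> = Inf {(LINT x:\<Omega>|lebesgue. norm (grad \<phi> x)) / (LINT x:\<Omega>|lebesgue. \<bar>\<phi> x\<bar>)
                     | \<phi>. \<phi> \<in> C1_0 \<Omega> \<and> (\<exists>x. \<phi> x \<noteq> 0)}"

end

theory Submission
  imports Defs
begin

text \<open>
  If \<open>u = 0\<close> is the minimizer, comparing it with \<open>t * \<bar>\<phi>\<bar>\<close> and letting \<open>t\<close> tend to \<open>0\<close> gives
  \<open>\<integral>\<bar>\<phi>\<bar> \<le> f'(0) \<integral>\<bar>D\<phi>\<bar>\<close> for every test function, i.e. \<open>h(\<Omega>) \<ge> 1 / f'(0)\<close>. Conversely, the Cheeger
  inequality extends from \<open>C\<^sup>1\<close> test functions to Lipschitz functions vanishing outside \<open>\<Omega>\<close> (truncate,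
  then average over small balls), so a minimizer \<open>u\<close> satisfies
  \<open>\<integral>\<bar>u\<bar> \<le> f'(0) \<integral>\<bar>Du\<bar> \<le> \<integral>f(\<bar>Du\<bar>) \<le> \<integral>u \<le> \<integral>\<bar>u\<bar>\<close>. Since \<open>f(s) > f'(0) s\<close> for \<open>s > 0\<close>, equality
  throughout forces \<open>Du = 0\<close> almost everywhere and hence \<open>u = 0\<close>.

  The gradient of a Lipschitz function is meaningful only through Rademacher's theorem. Its
  one-dimensional case is Lebesgue's differentiation theorem for monotone functions, by two Vitali
  coverings; directional derivatives then exist almost everywhere by Fubini's theorem, and their
  linearity follows from the covering-free argument of Nekvinda and Zajicek.
\<close>

section \<open>Differentiability of Lipschitz functions on the line\<close>

text \<open>Three obstacles shape the proof. On the line, slopes are taken over intervals containing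
  the point in their interior. Any slope condition on such intervals describes an open set, which
  settles measurability, and the intervals are themselves the balls of Vitali's theorem. At points
  of non-differentiability \<open>grad\<close> is an arbitrary choice, so gradient statements hold
  only almost everywhere, and integrals pass through a Borel representative. Chain rules for
  \<open>\<bar>\<phi>\<bar>\<close> and for truncations are replaced by one principle: if the
  increments of \<open>v\<close> at a point are dominated by those of \<open>u\<close>, so is the
  gradient norm. The boundary of \<open>\<Omega>\<close> may be irregular, and a multiplicative
  cutoff near it would add an uncontrolled term to the gradient. Subtracting from \<open>u\<close>
  its truncation at level \<open>e\<close> makes the support compact without enlarging any
  increment. Averaging over a ball with its sharp indicator then suffices as a mollifier: it turns a
  Lipschitz function into a C1 function and does not increase the integral of the gradient
  norm.\<close>

lemma Vitali_covering_theorem_open_intervals: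
  fixes S :: "real set"
  assumes "\<And>x d. x \<in> S \<Longrightarrow> 0 < d \<Longrightarrow> \<exists>a b. a < x \<and> x < b \<and> b - a < d \<and> P a b"
  obtains C where "countable C" "\<And>i. i \<in> C \<Longrightarrow> fst i < snd i \<and> P (fst i) (snd i)"
    "disjoint_family_on (\<lambda>i. {fst i<..<snd i}) C"
    "negligible (S - (\<Union>i\<in>C. {fst i<..<snd i}))"
proof -
  define K where "K = {i. fst i < snd i \<and> P (fst i) (snd i)}"
  define m where "m = (\<lambda>i::real\<times>real. (fst i + snd i) / 2)"
  define r where "r = (\<lambda>i::real\<times>real. (snd i - fst i) / 2)"
  have ball: "ball (m i) (r i) = {fst i<..<snd i}" for i
    by (auto simp: ball_eq_greaterThanLessThan m_def r_def field_simps)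
  have cov: "\<exists>i. i \<in> K \<and> x \<in> ball (m i) (r i) \<and> r i < d" if xd: "x \<in> S" "0 < d" for x d
  proof -
    obtain a b where "a < x" "x < b" "b - a < d" "P a b" using assms[OF xd] by blast
    thus ?thesis
      unfolding ball by (intro exI[of _ "(a,b)"]) (auto simp: K_def r_def)
  qed
  obtain C where C: "countable C" "C \<subseteq> K"
     "pairwise (\<lambda>i j. disjnt (ball (m i) (r i)) (ball (m j) (r j))) C"
     "negligible(S - (\<Union>i \<in> C. ball (m i) (r i)))"
    by (rule Vitali_covering_theorem_balls[OF cov])
  show ?thesis
  proof (rule that[OF C(1)])
    show "fst i < snd i \<and> P (fst i) (snd i)" if "i \<in> C" for i
      using that C(2) by (auto simp: K_def)
    show "disjoint_family_on (\<lambda>i. {fst i<..<snd i}) C"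
      using C(3) unfolding ball pairwise_def disjnt_def disjoint_family_on_def by blast
    show "negligible (S - (\<Union>i\<in>C. {fst i<..<snd i}))"
      using C(4) unfolding ball .
  qed
qed

text \<open>Continuity of \<open>g\<close> leaves no mass at end points, so on the open intervals of
  a Vitali family the Stieltjes measure is exactly the increment of \<open>g\<close>.\<close>

lemma emeasure_interval_measure_Ioo:
  fixes g :: "real \<Rightarrow> real"
  assumes "a \<le> b" and mono: "mono g" and cont: "continuous_on UNIV g"
  shows "emeasure (interval_measure g) {a<..<b} = g b - g a"
proof (cases "a = b")
  case False
  hence "a < b" using assms by simp
  have g: "\<And>x y. x \<le> y \<Longrightarrow> g x \<le> g y" using mono by (rule monoD)
  have s: "emeasure (interval_measure g) {b} = 0"
    using emeasure_interval_measure_Icc[of b b g, OF _ g cont] by simp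
  have "emeasure (interval_measure g) {a<..b} = g b - g a"
    using g cont \<open>a < b\<close>
    by (intro emeasure_interval_measure_Ioc) (auto simp: continuous_on_eq_continuous_within intro: continuous_within_subset)
  moreover have "{a<..b} = {a<..<b} \<union> {b}" using \<open>a < b\<close> by auto
  moreover have "emeasure (interval_measure g) ({a<..<b} \<union> {b}) = emeasure (interval_measure g) {a<..<b}"
    by (rule emeasure_Un_null_set) (use s in \<open>auto simp: null_sets_def\<close>)
  ultimately show ?thesis by simp
qed simp

lemma emeasure_lborel_le_if_negligible_diff:
  fixes S V :: "'a::euclidean_space set"
  assumes "S \<in> sets borel" "V \<in> sets borel" "negligible (S - V)"
  shows "emeasure lborel S \<le> emeasure lborel V"
proof -
  have "S - V \<in> null_sets lborel"
    using assms by (simp add: negligible_iff_null_sets null_sets_completion_iff)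
  hence "emeasure lborel (V \<union> (S - V)) = emeasure lborel V"
    using assms by (intro emeasure_Un_null_set) auto
  moreover have "emeasure lborel S \<le> emeasure lborel (V \<union> (S - V))"
    using assms by (intro emeasure_mono) auto
  ultimately show ?thesis by simp
qed

text \<open>Inside an open \<open>U\<close> of measure at most \<open>s + e\<close>, disjoint
  intervals of slope below \<open>p\<close> give a set \<open>V\<close> of Stieltjes measure at most
  \<open>p * (s + e)\<close>. Inside \<open>V\<close>, disjoint intervals of slope above
  \<open>q\<close> still cover almost all of \<open>S\<close>, so \<open>V\<close> has Stieltjes
  measure at least \<open>q * s\<close>. As \<open>e\<close> tends to 0 this contradicts
  \<open>p < q\<close> unless \<open>s = 0\<close>.\<close>

lemma null_set_two_difference_quotients:
  fixes g :: "real \<Rightarrow> real" and S :: "real set"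
  assumes mono: "mono g" and cont: "continuous_on UNIV g"
    and S: "S \<in> sets borel" "bounded S" and pq: "0 \<le> p" "p < q"
    and lo: "\<And>x d. x \<in> S \<Longrightarrow> 0 < d \<Longrightarrow> \<exists>a b. a < x \<and> x < b \<and> b - a < d \<and> g b - g a < p * (b - a)"
    and hi: "\<And>x d. x \<in> S \<Longrightarrow> 0 < d \<Longrightarrow> \<exists>a b. a < x \<and> x < b \<and> b - a < d \<and> g b - g a > q * (b - a)"
  shows "S \<in> null_sets lborel"
proof -
  let ?\<mu> = "interval_measure g"
  have fin: "emeasure lborel S < \<infinity>"
    using S(2) by (rule emeasure_bounded_finite)
  define s where "s = measure lborel S"
  have s: "emeasure lborel S = ennreal s" "s \<ge> 0"
    using fin by (auto simp: s_def emeasure_eq_ennreal_measure)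
  have key: "q * s \<le> p * (s + e)" if e: "e > 0" for e
  proof -
    obtain U where U: "open U" "S \<subseteq> U" "U - S \<in> lmeasurable" "emeasure lebesgue (U - S) < ennreal e"
      using sets_lebesgue_outer_open[of S e] S e by auto
    have "emeasure lborel (S \<union> (U - S)) \<le> emeasure lborel S + emeasure lborel (U - S)"
      using U S by (intro emeasure_subadditive) auto
    moreover have "emeasure lborel (U - S) \<le> ennreal e" 
      using U S by (simp add: emeasure_completion less_imp_le)
    moreover have "S \<union> (U - S) = U" using U by auto
    ultimately have "emeasure lborel U \<le> ennreal s + ennreal e"
      using s(1) by (simp add: add_left_mono order_trans)
    hence lamU: "emeasure lborel U \<le> ennreal (s + e)"
      using s e by simp
    obtain C where C: "countable C"
      "\<And>i. i \<in> C \<Longrightarrow> fst i < snd i \<and> {fst i<..<snd i} \<subseteq> U \<and> g (snd i) - g (fst i) < p * (snd i - fst i)"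
      "disjoint_family_on (\<lambda>i. {fst i<..<snd i}) C"
      "negligible (S - (\<Union>i\<in>C. {fst i<..<snd i}))"
    proof (rule Vitali_covering_theorem_open_intervals[of S "\<lambda>a b. {a<..<b} \<subseteq> U \<and> g b - g a < p * (b - a)"])
      fix x d :: real assume x: "x \<in> S" "0 < d"
      obtain r where r: "r > 0" "ball x r \<subseteq> U" using U x openE by blast
      obtain a b where ab: "a < x" "x < b" "b - a < min d r" "g b - g a < p * (b - a)"
        using lo[of x "min d r"] x r by auto
      have "{a<..<b} \<subseteq> ball x r" using ab by (auto simp: dist_real_def)
      thus "\<exists>a b. a < x \<and> x < b \<and> b - a < d \<and> {a<..<b} \<subseteq> U \<and> g b - g a < p * (b - a)"
        using ab r by (intro exI[of _ a] exI[of _ b]) auto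
    qed (rule that)
    define V where "V = (\<Union>i\<in>C. {fst i<..<snd i})"
    have V: "open V" "V \<subseteq> U" using C(2) by (auto simp: V_def)
    obtain D where D: "countable D"
      "\<And>i. i \<in> D \<Longrightarrow> fst i < snd i \<and> {fst i<..<snd i} \<subseteq> V \<and> g (snd i) - g (fst i) > q * (snd i - fst i)"
      "disjoint_family_on (\<lambda>i. {fst i<..<snd i}) D"
      "negligible (S \<inter> V - (\<Union>i\<in>D. {fst i<..<snd i}))"
    proof (rule Vitali_covering_theorem_open_intervals[of "S \<inter> V" "\<lambda>a b. {a<..<b} \<subseteq> V \<and> g b - g a > q * (b - a)"])
      fix x d :: real assume x: "x \<in> S \<inter> V" "0 < d"
      obtain r where r: "r > 0" "ball x r \<subseteq> V" using V x openE by blast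
      obtain a b where ab: "a < x" "x < b" "b - a < min d r" "g b - g a > q * (b - a)"
        using hi[of x "min d r"] x r by auto
      have "{a<..<b} \<subseteq> ball x r" using ab by (auto simp: dist_real_def)
      thus "\<exists>a b. a < x \<and> x < b \<and> b - a < d \<and> {a<..<b} \<subseteq> V \<and> g b - g a > q * (b - a)"
        using ab r by (intro exI[of _ a] exI[of _ b]) auto
    qed (rule that)
    define W where "W = (\<Union>i\<in>D. {fst i<..<snd i})"
    have W: "open W" "W \<subseteq> V" using D(2) by (auto simp: W_def)
    \<comment> \<open>The second family was required to cover only \<open>S \<inter> V\<close>; the
      part of \<open>S\<close> outside \<open>V\<close> was already lost as a null set in the first
      covering.\<close>
    have "negligible ((S - V) \<union> (S \<inter> V - W))"
      using C(4) D(4) by (intro negligible_Un) (auto simp: V_def W_def)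
    hence "negligible (S - W)" by (rule negligible_subset) auto
    hence "ennreal q * emeasure lborel S \<le> ennreal q * emeasure lborel W"
      using S W by (intro mult_left_mono emeasure_lborel_le_if_negligible_diff) auto
    also have "\<dots> = (\<integral>\<^sup>+i. ennreal q * emeasure lborel {fst i<..<snd i} \<partial>count_space D)"
      unfolding W_def using D by (subst emeasure_UN_countable) (auto simp: nn_integral_cmult)
    also have "\<dots> \<le> (\<integral>\<^sup>+i. emeasure ?\<mu> {fst i<..<snd i} \<partial>count_space D)"
    proof (rule nn_integral_mono)
      fix i assume "i \<in> space (count_space D)"
      hence i: "fst i \<le> snd i" "q * (snd i - fst i) \<le> g (snd i) - g (fst i)"
        using D(2)[of i] by auto
      show "ennreal q * emeasure lborel {fst i<..<snd i} \<le> emeasure ?\<mu> {fst i<..<snd i}"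
        unfolding emeasure_interval_measure_Ioo[OF i(1) mono cont] emeasure_lborel_Ioo[OF i(1)]
        using i pq by (simp add: ennreal_leI flip: ennreal_mult)
    qed
    also have "\<dots> = emeasure ?\<mu> W"
      unfolding W_def using D by (subst emeasure_UN_countable) auto
    also have "\<dots> \<le> emeasure ?\<mu> V"
      using V W by (intro emeasure_mono) auto
    also have "\<dots> = (\<integral>\<^sup>+i. emeasure ?\<mu> {fst i<..<snd i} \<partial>count_space C)"
      unfolding V_def using C by (subst emeasure_UN_countable) auto
    also have "\<dots> \<le> (\<integral>\<^sup>+i. ennreal p * emeasure lborel {fst i<..<snd i} \<partial>count_space C)"
    proof (rule nn_integral_mono)
      fix i assume "i \<in> space (count_space C)"
      hence i: "fst i \<le> snd i" "g (snd i) - g (fst i) \<le> p * (snd i - fst i)"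
        using C(2)[of i] by auto
      show "emeasure ?\<mu> {fst i<..<snd i} \<le> ennreal p * emeasure lborel {fst i<..<snd i}"
        unfolding emeasure_interval_measure_Ioo[OF i(1) mono cont] emeasure_lborel_Ioo[OF i(1)]
        using i pq by (simp add: ennreal_leI flip: ennreal_mult)
    qed
    also have "\<dots> = ennreal p * emeasure lborel V"
      unfolding V_def using C by (subst emeasure_UN_countable) (auto simp: nn_integral_cmult)
    also have "\<dots> \<le> ennreal p * emeasure lborel U"
      using V U by (intro mult_left_mono emeasure_mono) auto
    also have "\<dots> \<le> ennreal p * ennreal (s + e)"
      by (intro mult_left_mono lamU) auto
    finally have "ennreal (q * s) \<le> ennreal (p * (s + e))"
      using pq s e by (simp add: ennreal_mult)
    thus ?thesis
      using pq s e by (subst (asm) ennreal_le_iff) auto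
  qed
  have "q * s \<le> p * s"
  proof (rule field_le_epsilon)
    fix e :: real assume "e > 0"
    \<comment> \<open>Dividing by \<open>p + 1\<close> instead of \<open>p\<close> keeps the case
      \<open>p = 0\<close> inside the argument.\<close>
    hence "q * s \<le> p * (s + e / (p + 1))" using pq by (intro key) auto
    also have "\<dots> \<le> p * s + e" using pq \<open>e > 0\<close> by (simp add: field_simps)
    finally show "q * s \<le> p * s + e" .
  qed
  hence "s = 0" using pq s by (simp add: mult_le_cancel_right)
  thus ?thesis using s S by auto
qed

section \<open>Slopes of short intervals straddling a point\<close>

lemma open_straddling_intervals:
  fixes P :: "real \<Rightarrow> real \<Rightarrow> bool"
  shows "open {x. \<exists>a b. a < x \<and> x < b \<and> P a b}"
proof -
  have "{x. \<exists>a b. a < x \<and> x < b \<and> P a b} = (\<Union>(a, b)\<in>{(a,b). P a b}. {a<..<b})"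
    by (rule set_eqI) (simp add: Bex_def, blast)
  thus ?thesis by (auto intro!: open_UN)
qed

text \<open>The lengths \<open>1 / real (Suc n)\<close> in place of all positive lengths make this a
  countable intersection of open sets. Membership says that arbitrarily short straddling intervals
  have slope below \<open>p\<close>.\<close>

definition lower_quotient_points :: "(real \<Rightarrow> real) \<Rightarrow> real \<Rightarrow> real set" where
  "lower_quotient_points g p =
     (\<Inter>n. {x. \<exists>a b. a < x \<and> x < b \<and> b - a < 1 / real (Suc n) \<and> g b - g a < p * (b - a)})"

definition upper_quotient_points :: "(real \<Rightarrow> real) \<Rightarrow> real \<Rightarrow> real set" where
  "upper_quotient_points g q =
     (\<Inter>n. {x. \<exists>a b. a < x \<and> x < b \<and> b - a < 1 / real (Suc n) \<and> g b - g a > q * (b - a)})"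

lemma quotient_points_borel [measurable]:
  "lower_quotient_points g p \<in> sets borel" "upper_quotient_points g q \<in> sets borel"
  unfolding lower_quotient_points_def upper_quotient_points_def
  by (rule sets.countable_INT', use borel_open[OF open_straddling_intervals] in auto)+

lemma in_lower_quotient_points:
  "x \<in> lower_quotient_points g p \<longleftrightarrow>
     (\<forall>d>0. \<exists>a b. a < x \<and> x < b \<and> b - a < d \<and> g b - g a < p * (b - a))"
proof
  assume x: "x \<in> lower_quotient_points g p"
  show "\<forall>d>0. \<exists>a b. a < x \<and> x < b \<and> b - a < d \<and> g b - g a < p * (b - a)"
  proof safe
    fix d :: real assume "d > 0"
    then obtain n where "1 / real (Suc n) < d" by (rule nat_approx_posE)
    moreover obtain a b where "a < x" "x < b" "b - a < 1 / real (Suc n)" "g b - g a < p * (b - a)"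
      using x unfolding lower_quotient_points_def by blast
    ultimately show "\<exists>a b. a < x \<and> x < b \<and> b - a < d \<and> g b - g a < p * (b - a)"
      by (intro exI[of _ a] exI[of _ b]) auto
  qed
qed (auto simp: lower_quotient_points_def)

lemma upper_quotient_points_uminus:
  "upper_quotient_points g q = lower_quotient_points (\<lambda>x. - g x) (- q)"
  unfolding upper_quotient_points_def lower_quotient_points_def by (auto simp: algebra_simps)

lemma in_upper_quotient_points:
  "x \<in> upper_quotient_points g q \<longleftrightarrow>
     (\<forall>d>0. \<exists>a b. a < x \<and> x < b \<and> b - a < d \<and> g b - g a > q * (b - a))"
  unfolding upper_quotient_points_uminus in_lower_quotient_points by (simp add: algebra_simps)

text \<open>For negative \<open>p\<close> a monotone \<open>g\<close> has no slope below
  \<open>p\<close>. Otherwise the covering estimate, which needs a bounded set, is applied in the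
  windows from \<open>- real n\<close> to \<open>real n\<close>.\<close>

lemma null_set_lower_upper_quotient_points:
  fixes g :: "real \<Rightarrow> real"
  assumes mono: "mono g" and cont: "continuous_on UNIV g" and "p < q"
  shows "lower_quotient_points g p \<inter> upper_quotient_points g q \<in> null_sets lborel"
proof (cases "0 \<le> p")
  case False
  have "g b - g a \<ge> p * (b - a)" if "a < b" for a b
  proof -
    have "p * (b - a) \<le> 0" using False that by (simp add: mult_le_0_iff)
    thus ?thesis using monoD[OF mono, of a b] that by simp
  qed
  hence "lower_quotient_points g p = {}"
    using zero_less_one by (metis equals0I in_lower_quotient_points less_trans not_le)
  thus ?thesis by simp
next
  case True
  let ?A = "lower_quotient_points g p \<inter> upper_quotient_points g q"
  have "?A \<inter> {- real n<..<real n} \<in> null_sets lborel" for n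
  proof (rule null_set_two_difference_quotients[OF mono cont _ _ True \<open>p < q\<close>])
    show "bounded (?A \<inter> {- real n<..<real n})"
      by (rule bounded_subset[of "{- real n<..<real n}"]) auto
  qed (auto simp: in_lower_quotient_points in_upper_quotient_points)
  hence "(\<Union>n. ?A \<inter> {- real n<..<real n}) \<in> null_sets lborel" by blast
  moreover have "(\<Union>n. ?A \<inter> {- real n<..<real n}) = ?A"
  proof -
    have "\<exists>n. - real n < x \<and> x < real n" for x
      using reals_Archimedean2[of "\<bar>x\<bar>"] by (auto simp: abs_less_iff minus_less_iff)
    thus ?thesis by auto
  qed
  ultimately show ?thesis by simp
qed

text \<open>Intervals straddling \<open>x\<close> control the intervals with end point \<open>x\<close> by continuity.\<close>
lemma differentiable_if_quotients_agree:
  fixes g :: "real \<Rightarrow> real"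
  assumes mono: "mono g" and lip: "L-lipschitz_on UNIV g"
    and x: "\<And>p q. p \<in> \<rat> \<Longrightarrow> q \<in> \<rat> \<Longrightarrow> p < q \<Longrightarrow>
              x \<notin> lower_quotient_points g p \<inter> upper_quotient_points g q"
  shows "g differentiable (at x)"
proof -
  have cont: "continuous_on UNIV g" using lip by (rule lipschitz_on_continuous_on)
  define P where "P = {p. x \<in> lower_quotient_points g p}"
  have up: "g b - g a \<le> L * (b - a)" if "a < b" for a b
    using lipschitz_onD[OF lip, of a b] that by (auto simp: dist_real_def)
  have bdd: "p \<ge> 0" if p: "p \<in> P" for p
  proof -
    obtain a b where ab: "a < x" "x < b" "g b - g a < p * (b - a)"
      using p zero_less_one unfolding P_def in_lower_quotient_points by blast
    have "g a \<le> g b" using monoD[OF mono, of a b] ab by simp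
    hence "0 < p * (b - a)" using ab by linarith
    thus ?thesis using ab by (simp add: zero_less_mult_iff)
  qed
  \<comment> \<open>Slopes are at most \<open>L\<close>, and membership in \<open>P\<close> asks for
    a strict inequality, hence the extra 1.\<close>
  have ne: "L + 1 \<in> P"
    unfolding P_def in_lower_quotient_points mem_Collect_eq
  proof safe
    fix d :: real assume "d > 0"
    thus "\<exists>a b. a < x \<and> x < b \<and> b - a < d \<and> g b - g a < (L + 1) * (b - a)"
      using up[of "x - d/3" "x + d/3"]
      by (intro exI[of _ "x - d/3"] exI[of _ "x + d/3"]) (auto simp: field_simps)
  qed
  \<comment> \<open>This is the lower derivative over straddling intervals: for \<open>p < l\<close>
    all short slopes are at least \<open>p\<close>, and the agreement hypothesis will bound them
    from above by any \<open>q > l\<close>.\<close>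
  define l where "l = Inf P"
  have lo: "\<exists>d>0. \<forall>a b. a < x \<and> x < b \<and> b - a < d \<longrightarrow> g b - g a \<ge> p * (b - a)" if "p < l" for p
  proof -
    have "p \<notin> P" using that cInf_lower[of p P] bdd unfolding l_def by (auto simp: bdd_below_def)
    thus ?thesis by (force simp: P_def in_lower_quotient_points not_less)
  qed
  have hi: "\<exists>d>0. \<forall>a b. a < x \<and> x < b \<and> b - a < d \<longrightarrow> g b - g a \<le> q * (b - a)" if ql: "q > l" for q
  proof -
    obtain p where p: "p \<in> P" "p < q"
      using cInf_lessD[of P q] ne ql unfolding l_def by blast
    \<comment> \<open>The hypothesis compares rational levels only, so two rationals are placed
      between \<open>p\<close> and \<open>q\<close>: \<open>p'\<close> inherits membership in
      \<open>P\<close> from \<open>p\<close>, which excludes \<open>x\<close> from the upper set at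
      level \<open>q'\<close>.\<close>
    obtain p' where p': "p' \<in> \<rat>" "p < p'" "p' < q" using Rats_dense_in_real[OF p(2)] by auto
    obtain q' where q': "q' \<in> \<rat>" "p' < q'" "q' < q" using Rats_dense_in_real[OF p'(3)] by auto
    have "p' \<in> P"
      unfolding P_def in_lower_quotient_points mem_Collect_eq
    proof safe
      fix d :: real assume "d > 0"
      then obtain a b where ab: "a < x" "x < b" "b - a < d" "g b - g a < p * (b - a)"
        using p unfolding P_def in_lower_quotient_points by blast
      moreover have "p * (b - a) \<le> p' * (b - a)" using p' ab by (intro mult_right_mono) auto
      ultimately show "\<exists>a b. a < x \<and> x < b \<and> b - a < d \<and> g b - g a < p' * (b - a)"
        using order_less_le_trans by blast
    qed
    hence "x \<notin> upper_quotient_points g q'"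
      using x[OF p'(1) q'(1,2)] by (auto simp: P_def)
    then obtain d where d: "d > 0"
      "\<And>a b. a < x \<Longrightarrow> x < b \<Longrightarrow> b - a < d \<Longrightarrow> g b - g a \<le> q' * (b - a)"
      by (force simp: in_upper_quotient_points not_less)
    show ?thesis
    proof (intro exI[of _ d] conjI allI impI d(1))
      fix a b assume ab: "a < x \<and> x < b \<and> b - a < d"
      hence "q' * (b - a) \<le> q * (b - a)" using q' by (intro mult_right_mono) auto
      thus "g b - g a \<le> q * (b - a)" using d(2)[of a b] ab by (blast intro: order_trans)
    qed
  qed
  have "(g has_real_derivative l) (at x)"
    unfolding has_field_derivative_iff
  proof (rule LIM_I)
    fix e :: real assume e: "e > 0"
    obtain d1 where d1: "d1 > 0"
      "\<And>a b. a < x \<Longrightarrow> x < b \<Longrightarrow> b - a < d1 \<Longrightarrow> g b - g a \<ge> (l - e/2) * (b - a)"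
      using lo[of "l - e/2"] e by auto
    obtain d2 where d2: "d2 > 0"
      "\<And>a b. a < x \<Longrightarrow> x < b \<Longrightarrow> b - a < d2 \<Longrightarrow> g b - g a \<le> (l + e/2) * (b - a)"
      using hi[of "l + e/2"] e by auto
    define d where "d = min d1 d2"
    have "\<bar>g b - g a - l * (b - a)\<bar> \<le> e/2 * (b - a)" if "a < x" "x < b" "b - a < d" for a b
    proof -
      have "(l - e/2) * (b - a) \<le> g b - g a" "g b - g a \<le> (l + e/2) * (b - a)"
        using d1(2)[of a b] d2(2)[of a b] that by (auto simp: d_def)
      moreover have "(l - e/2) * (b - a) = l * (b - a) - e/2 * (b - a)"
        "(l + e/2) * (b - a) = l * (b - a) + e/2 * (b - a)" by (simp_all only: ring_distribs)
      ultimately show ?thesis by (smt (verit))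
    qed
    \<comment> \<open>With everything on one side, the inequality is continuous in each end point,
      so it survives letting one of them tend to \<open>x\<close>.\<close>
    hence straddle: "\<bar>g b - g a - l * (b - a)\<bar> - e/2 * (b - a) \<le> 0" if "a < x" "x < b" "b - a < d" for a b
      using that by force
    have right: "\<bar>g b - g x - l * (b - x)\<bar> - e/2 * (b - x) \<le> 0" if b: "x < b" "b - x < d" for b
    proof (rule tendsto_upperbound)
      have "((\<lambda>a. g a) \<longlongrightarrow> g x) (at_left x)"
        using cont by (auto simp: continuous_on_eq_continuous_at isCont_def intro: filterlim_mono[OF _ order_refl at_le])
      thus "((\<lambda>a. \<bar>g b - g a - l * (b - a)\<bar> - e/2 * (b - a)) \<longlongrightarrow>
              \<bar>g b - g x - l * (b - x)\<bar> - e/2 * (b - x)) (at_left x)"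
        by (intro tendsto_intros)
      show "\<forall>\<^sub>F a in at_left x. \<bar>g b - g a - l * (b - a)\<bar> - e/2 * (b - a) \<le> 0"
        using b by (intro eventually_at_leftI[of "b - d"] straddle) auto
    qed simp
    have left: "\<bar>g x - g a - l * (x - a)\<bar> - e/2 * (x - a) \<le> 0" if a: "a < x" "x - a < d" for a
    proof (rule tendsto_upperbound)
      have "((\<lambda>a. g a) \<longlongrightarrow> g x) (at_right x)"
        using cont by (auto simp: continuous_on_eq_continuous_at isCont_def intro: filterlim_mono[OF _ order_refl at_le])
      thus "((\<lambda>b. \<bar>g b - g a - l * (b - a)\<bar> - e/2 * (b - a)) \<longlongrightarrow>
              \<bar>g x - g a - l * (x - a)\<bar> - e/2 * (x - a)) (at_right x)"
        by (intro tendsto_intros)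
      show "\<forall>\<^sub>F b in at_right x. \<bar>g b - g a - l * (b - a)\<bar> - e/2 * (b - a) \<le> 0"
        using a by (intro eventually_at_rightI[of _ "a + d"] straddle) auto
    qed simp
    show "\<exists>s>0. \<forall>y. y \<noteq> x \<and> norm (y - x) < s \<longrightarrow> norm ((g y - g x) / (y - x) - l) < e"
    proof (intro exI[of _ d] conjI allI impI)
      show "d > 0" using d1 d2 by (simp add: d_def)
      fix y assume y: "y \<noteq> x \<and> norm (y - x) < d"
      have "\<bar>g y - g x - l * (y - x)\<bar> \<le> e/2 * \<bar>y - x\<bar>"
      proof (cases "x < y")
        case True thus ?thesis using right[of y] y by auto
      next
        case False
        hence "y < x" using y by auto
        thus ?thesis using left[of y] y by (simp add: abs_if algebra_simps split: if_splits)
      qed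
      also have "\<dots> < e * \<bar>y - x\<bar>" using y e by simp
      finally have "\<bar>g y - g x - l * (y - x)\<bar> / \<bar>y - x\<bar> < e"
        using y by (simp add: field_simps)
      moreover have "(g y - g x) / (y - x) - l = (g y - g x - l * (y - x)) / (y - x)"
        using y by (simp add: field_simps)
      ultimately show "norm ((g y - g x) / (y - x) - l) < e"
        by (simp add: abs_divide)
    qed
  qed
  thus ?thesis by (metis differentiable_def has_field_derivative_imp_has_derivative)
qed

theorem lipschitz_on_real_AE_differentiable:
  fixes g :: "real \<Rightarrow> real"
  assumes lip: "L-lipschitz_on UNIV g"
  shows "AE x in lborel. g differentiable (at x)"
proof -
  \<comment> \<open>Adding \<open>L * x\<close> compensates the steepest possible descent and makes
    the function monotone; the linear term is removed again at the end without affecting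
    differentiability.\<close>
  define k where "k = (\<lambda>x. g x + L * x)"
  have k: "mono k"
  proof (rule monoI)
    fix a b :: real assume "a \<le> b"
    thus "k a \<le> k b"
      using lipschitz_onD[OF lip, of a b] by (auto simp: k_def dist_real_def algebra_simps abs_le_iff)
  qed
  have "L \<ge> 0" using lip by (rule lipschitz_on_nonneg)
  have klip: "(L + L)-lipschitz_on UNIV k"
    unfolding k_def
    by (intro lipschitz_on_add lip lipschitz_onI) (auto simp: dist_real_def \<open>L \<ge> 0\<close> abs_mult simp flip: right_diff_distrib)
  have kcont: "continuous_on UNIV k" using klip by (rule lipschitz_on_continuous_on)
  define A where "A = {(p,q). p \<in> \<rat> \<and> q \<in> \<rat> \<and> p < (q::real)}"
  have "A \<subseteq> \<rat> \<times> \<rat>" by (auto simp: A_def)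
  hence "countable A" by (rule countable_subset) (auto intro: countable_rat)
  have "AE x in lborel. \<forall>i\<in>A. x \<notin> lower_quotient_points k (fst i) \<inter> upper_quotient_points k (snd i)"
    unfolding AE_ball_countable[OF \<open>countable A\<close>]
  proof
    fix i assume "i \<in> A"
    hence "fst i < snd i" by (auto simp: A_def)
    thus "AE x in lborel. x \<notin> lower_quotient_points k (fst i) \<inter> upper_quotient_points k (snd i)"
      by (intro AE_not_in null_set_lower_upper_quotient_points k kcont)
  qed
  thus ?thesis
  proof eventually_elim
    case (elim x)
    have "k differentiable (at x)"
      by (rule differentiable_if_quotients_agree[OF k klip]) (use elim in \<open>auto simp: A_def\<close>)
    hence "(\<lambda>x. k x - L * x) differentiable (at x)" by (intro derivative_intros) auto
    thus ?case by (simp add: k_def)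
  qed
qed

section \<open>Rademacher's theorem\<close>

lemma nn_integral_lborel_translate:
  fixes f :: "'a::euclidean_space \<Rightarrow> ennreal"
  assumes [measurable]: "f \<in> borel_measurable borel"
  shows "(\<integral>\<^sup>+x. f (x + c) \<partial>lborel) = (\<integral>\<^sup>+x. f x \<partial>lborel)"
proof -
  have "(\<integral>\<^sup>+x. f x \<partial>lborel) = (\<integral>\<^sup>+x. f x \<partial>distr lborel borel ((+) c))"
    by (simp add: lborel_distr_plus)
  also have "\<dots> = (\<integral>\<^sup>+x. f (x + c) \<partial>lborel)"
    by (subst nn_integral_distr) (auto simp: add.commute)
  finally show ?thesis by simp
qed

lemma AE_lborel_translate:
  fixes c :: "'a::euclidean_space"
  assumes "AE x in lborel. P x"
  shows "AE x in lborel. P (x + c)"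
proof -
  have "AE x in distr lborel borel ((+) c). P x" unfolding lborel_distr_plus by (rule assms)
  hence "AE x in lborel. P (c + x)" by (rule AE_distrD[rotated]) auto
  thus ?thesis by (simp add: add.commute)
qed

text \<open>All translates of \<open>A\<close> by multiples of \<open>v\<close> have the same
  measure. Averaging over these translates and exchanging the integrals yields the measure of
  \<open>A\<close> from its sections along lines, without splitting the space into \<open>v\<close>
  and a complement.\<close>

lemma null_set_if_null_on_lines:
  fixes A :: "'a::euclidean_space set" and v :: 'a
  assumes A [measurable]: "A \<in> sets borel"
    and lines: "\<And>x. AE t in lborel. x + t *\<^sub>R v \<notin> A"
  shows "A \<in> null_sets lborel"
proof -
  \<comment> \<open>The window for \<open>t\<close> has length 1, so the outer integral returns the
    measure of \<open>A\<close> itself.\<close>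
  define F :: "'a \<Rightarrow> real \<Rightarrow> ennreal"
    where "F = (\<lambda>x t. indicator {0..1} t * indicator A (x + t *\<^sub>R v))"
  have [measurable]: "case_prod F \<in> borel_measurable (lborel \<Otimes>\<^sub>M lborel)"
    unfolding F_def by measurable
  have "(\<integral>\<^sup>+t. F x t \<partial>lborel) = 0" for x
  proof -
    have "(\<integral>\<^sup>+t. F x t \<partial>lborel) = (\<integral>\<^sup>+t. 0 \<partial>(lborel :: real measure))"
      by (rule nn_integral_cong_AE) (use lines[of x] in \<open>auto simp: F_def\<close>)
    thus ?thesis by simp
  qed
  hence "0 = (\<integral>\<^sup>+x. (\<integral>\<^sup>+t. F x t \<partial>lborel) \<partial>lborel)" by simp
  also have "\<dots> = (\<integral>\<^sup>+t. (\<integral>\<^sup>+x. F x t \<partial>lborel) \<partial>lborel)"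
    by (rule lborel_pair.Fubini'[symmetric]) measurable
  also have "\<dots> = (\<integral>\<^sup>+t. indicator {0..1::real} t * emeasure lborel A \<partial>lborel)"
  proof (rule nn_integral_cong)
    fix t :: real
    have "(\<integral>\<^sup>+x. indicator A (x + t *\<^sub>R v) \<partial>lborel) = emeasure lborel A"
      by (subst nn_integral_lborel_translate) auto
    thus "(\<integral>\<^sup>+x. F x t \<partial>lborel) = indicator {0..1} t * emeasure lborel A"
      unfolding F_def by (subst nn_integral_cmult) auto
  qed
  also have "\<dots> = emeasure lborel A" by (simp add: nn_integral_multc)
  finally show ?thesis by auto
qed

section \<open>Directional derivatives and measurability of their domain\<close>

definition has_dir_deriv :: "('a::euclidean_space \<Rightarrow> real) \<Rightarrow> 'a \<Rightarrow> 'a \<Rightarrow> real \<Rightarrow> bool" where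
  "has_dir_deriv u v x l \<longleftrightarrow> ((\<lambda>t. u (x + t *\<^sub>R v)) has_real_derivative l) (at 0)"

text \<open>Fixing slope \<open>y\<close>, tolerance \<open>e\<close> and scale \<open>d\<close>
  gives a set that is closed for continuous \<open>u\<close>, being an intersection over all small
  \<open>t\<close>. Differentiability then becomes a countable combination of such sets with
  rational parameters.\<close>

definition approx_dir_deriv :: "('a::euclidean_space \<Rightarrow> real) \<Rightarrow> 'a \<Rightarrow> real \<Rightarrow> real \<Rightarrow> real \<Rightarrow> 'a set" where
  "approx_dir_deriv u v y e d =
     {x. \<forall>t. \<bar>t\<bar> < d \<longrightarrow> \<bar>u (x + t *\<^sub>R v) - u x - t * y\<bar> \<le> e * \<bar>t\<bar>}"

lemma approx_dir_derivD:
  "x \<in> approx_dir_deriv u v y e d \<Longrightarrow> \<bar>t\<bar> < d \<Longrightarrow> \<bar>u (x + t *\<^sub>R v) - u x - t * y\<bar> \<le> e * \<bar>t\<bar>"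
  by (simp add: approx_dir_deriv_def)

lemma closed_approx_dir_deriv:
  assumes "continuous_on UNIV u"
  shows "closed (approx_dir_deriv u v y e d)"
proof -
  have "approx_dir_deriv u v y e d =
          (\<Inter>t\<in>{t. \<bar>t\<bar> < d}. {x. \<bar>u (x + t *\<^sub>R v) - u x - t * y\<bar> \<le> e * \<bar>t\<bar>})"
    by (auto simp: approx_dir_deriv_def)
  moreover have "closed {x. \<bar>u (x + t *\<^sub>R v) - u x - t * y\<bar> \<le> e * \<bar>t\<bar>}" for t
    by (intro closed_Collect_le continuous_intros continuous_on_compose2[OF assms]) auto
  ultimately show ?thesis by auto
qed

lemma approx_dir_deriv_mono:
  "d' \<le> d \<Longrightarrow> approx_dir_deriv u v y e d \<subseteq> approx_dir_deriv u v y e d'"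
  by (auto simp: approx_dir_deriv_def)

lemma has_dir_deriv_iff:
  "has_dir_deriv u v x l \<longleftrightarrow>
     (\<forall>e>0. \<exists>d>0. \<forall>t. \<bar>t\<bar> < d \<longrightarrow> \<bar>u (x + t *\<^sub>R v) - u x - t * l\<bar> \<le> e * \<bar>t\<bar>)"
  unfolding has_dir_deriv_def has_field_derivative_def has_derivative_at_alt
  by (auto simp: bounded_linear_mult_right mult.commute)

text \<open>The slack \<open>e - \<bar>y - l\<bar>\<close> serves as the tolerance for the true
  derivative, and the rest of \<open>e\<close> pays for replacing \<open>l\<close> by
  \<open>y\<close>.\<close>

lemma has_dir_deriv_imp_approx:
  assumes "has_dir_deriv u v x l" "\<bar>y - l\<bar> < e"
  obtains d where "d \<in> \<rat>" "d > 0" "x \<in> approx_dir_deriv u v y e d"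
proof -
  obtain d where d: "d > 0"
    "\<And>t. \<bar>t\<bar> < d \<Longrightarrow> \<bar>u (x + t *\<^sub>R v) - u x - t * l\<bar> \<le> (e - \<bar>y - l\<bar>) * \<bar>t\<bar>"
    using assms unfolding has_dir_deriv_iff by (meson diff_gt_0_iff_gt)
  obtain d' where d': "d' \<in> \<rat>" "0 < d'" "d' < d" using Rats_dense_in_real[OF d(1)] by auto
  have "x \<in> approx_dir_deriv u v y e d'"
    unfolding approx_dir_deriv_def
  proof safe
    fix t :: real assume t: "\<bar>t\<bar> < d'"
    have "\<bar>u (x + t *\<^sub>R v) - u x - t * y\<bar> \<le> \<bar>u (x + t *\<^sub>R v) - u x - t * l\<bar> + \<bar>t * (y - l)\<bar>"
      by (simp add: algebra_simps)
    also have "\<dots> \<le> (e - \<bar>y - l\<bar>) * \<bar>t\<bar> + \<bar>t * (y - l)\<bar>"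
      using d(2)[of t] t d' by simp
    also have "\<dots> = e * \<bar>t\<bar>" unfolding abs_mult by (simp add: algebra_simps)
    finally show "\<bar>u (x + t *\<^sub>R v) - u x - t * y\<bar> \<le> e * \<bar>t\<bar>" .
  qed
  thus ?thesis using that d' by blast
qed

text \<open>Slopes admissible for tolerances \<open>e m\<close> and \<open>e n\<close> approximate
  the same difference quotient at a common small \<open>t\<close>, so they differ by at most
  \<open>e m + e n\<close>. They form a Cauchy sequence whose limit is the derivative.\<close>

lemma has_dir_deriv_if_approx:
  assumes "\<And>e. e > 0 \<Longrightarrow> e \<in> \<rat> \<Longrightarrow> \<exists>y d. d > 0 \<and> x \<in> approx_dir_deriv u v y e d"
  shows "\<exists>l. has_dir_deriv u v x l"
proof -
  define e where "e = (\<lambda>n. 1 / real (Suc n))"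
  have e: "e n > 0" "e n \<in> \<rat>" for n by (auto simp: e_def)
  have "\<exists>y d. d > 0 \<and> x \<in> approx_dir_deriv u v y (e n) d" for n
    by (rule assms) (auto simp: e)
  then obtain y d where yd: "\<And>n. d n > 0" "\<And>n. x \<in> approx_dir_deriv u v (y n) (e n) (d n)"
    by metis
  have diff: "\<bar>y m - y n\<bar> \<le> e m + e n" for m n
  proof -
    define t where "t = min (d m) (d n) / 2"
    have t: "t > 0" "t < d m" "t < d n" using yd(1)[of m] yd(1)[of n] by (auto simp: t_def min_def)
    have "\<bar>u (x + t *\<^sub>R v) - u x - t * y m\<bar> \<le> e m * t" "\<bar>u (x + t *\<^sub>R v) - u x - t * y n\<bar> \<le> e n * t"
      using approx_dir_derivD[OF yd(2)[of m], of t] approx_dir_derivD[OF yd(2)[of n], of t] t by simp_all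
    hence "\<bar>t * y m - t * y n\<bar> \<le> e m * t + e n * t" by linarith
    moreover have "\<bar>t * y m - t * y n\<bar> = t * \<bar>y m - y n\<bar>"
      using t by (simp add: abs_mult flip: right_diff_distrib)
    ultimately have "t * \<bar>y m - y n\<bar> \<le> t * (e m + e n)"
      by (simp add: algebra_simps)
    thus ?thesis using t by (simp add: mult_le_cancel_left)
  qed
  have elim: "e \<longlonglongrightarrow> 0" unfolding e_def by (rule LIMSEQ_Suc[OF lim_const_over_n])
  have "Cauchy y"
  proof (rule metric_CauchyI)
    fix r :: real assume "r > 0"
    then obtain N where N: "\<And>n. n \<ge> N \<Longrightarrow> e n < r / 2"
      using order_tendstoD(2)[OF elim, of "r/2"] by (auto simp: eventually_sequentially)
    show "\<exists>M. \<forall>m\<ge>M. \<forall>n\<ge>M. dist (y m) (y n) < r"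
    proof (intro exI[of _ N] allI impI)
      fix m n assume "m \<ge> N" "n \<ge> N"
      thus "dist (y m) (y n) < r" using diff[of m n] N[of m] N[of n] by (simp add: dist_real_def)
    qed
  qed
  then obtain l where l: "y \<longlonglongrightarrow> l" using Cauchy_convergent_iff convergent_def by blast
  have "has_dir_deriv u v x l"
    unfolding has_dir_deriv_iff
  proof safe
    fix r :: real assume "r > 0"
    have "(\<lambda>n. e n + \<bar>y n - l\<bar>) \<longlonglongrightarrow> 0 + \<bar>l - l\<bar>" by (intro tendsto_intros elim l)
    hence "\<forall>\<^sub>F n in sequentially. e n + \<bar>y n - l\<bar> < r"
      using \<open>r > 0\<close> by (intro order_tendstoD(2)[where a = r]) auto
    then obtain n where n: "e n + \<bar>y n - l\<bar> < r" by (auto simp: eventually_sequentially)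
    show "\<exists>d>0. \<forall>t. \<bar>t\<bar> < d \<longrightarrow> \<bar>u (x + t *\<^sub>R v) - u x - t * l\<bar> \<le> r * \<bar>t\<bar>"
    proof (intro exI[of _ "d n"] conjI yd allI impI)
      fix t assume t: "\<bar>t\<bar> < d n"
      have "\<bar>u (x + t *\<^sub>R v) - u x - t * l\<bar> \<le> \<bar>u (x + t *\<^sub>R v) - u x - t * y n\<bar> + \<bar>t * (y n - l)\<bar>"
        by (simp add: algebra_simps)
      also have "\<dots> \<le> e n * \<bar>t\<bar> + \<bar>t * (y n - l)\<bar>"
        using yd(2)[of n] t by (simp add: approx_dir_deriv_def)
      also have "\<dots> = (e n + \<bar>y n - l\<bar>) * \<bar>t\<bar>" unfolding abs_mult by (simp add: algebra_simps)
      also have "\<dots> \<le> r * \<bar>t\<bar>" using n by (intro mult_right_mono) auto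
      finally show "\<bar>u (x + t *\<^sub>R v) - u x - t * l\<bar> \<le> r * \<bar>t\<bar>" .
    qed
  qed
  thus ?thesis ..
qed

lemma has_dir_deriv_set_eq:
  "{x. \<exists>l. has_dir_deriv u v x l} =
     (\<Inter>e\<in>{e\<in>\<rat>. e > 0}. \<Union>y\<in>\<rat>. \<Union>d\<in>{d\<in>\<rat>. d > 0}. approx_dir_deriv u v y e d)" (is "?L = ?R")
proof
  show "?L \<subseteq> ?R"
  proof safe
    fix x l and e :: real assume *: "has_dir_deriv u v x l" "e > 0"
    obtain y where "y \<in> \<rat>" "l < y" "y < l + e" using Rats_dense_in_real[of l "l + e"] * by auto
    moreover from this have "\<bar>y - l\<bar> < e" by auto
    then obtain d where "d \<in> \<rat>" "d > 0" "x \<in> approx_dir_deriv u v y e d"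
      using has_dir_deriv_imp_approx[OF *(1)] by blast
    ultimately show "x \<in> (\<Union>y\<in>\<rat>. \<Union>d\<in>{d\<in>\<rat>. d > 0}. approx_dir_deriv u v y e d)" by blast
  qed
  show "?R \<subseteq> ?L"
    by (rule subsetI, rule CollectI, rule has_dir_deriv_if_approx) blast
qed

lemma borel_has_dir_deriv_set:
  assumes "continuous_on UNIV u"
  shows "{x. \<exists>l. has_dir_deriv u v x l} \<in> sets borel"
proof -
  have Q: "countable {e::real\<in>\<rat>. e > 0}"
    by (rule countable_subset[OF _ countable_rat]) auto
  have "(\<Union>y\<in>\<rat>. \<Union>d\<in>{d\<in>\<rat>. d > 0}. approx_dir_deriv u v y e d) \<in> sets borel" for e
    by (intro sets.countable_UN'' countable_rat Q borel_closed closed_approx_dir_deriv assms)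
  moreover have "1 \<in> {e::real\<in>\<rat>. e > 0}" by auto
  ultimately show ?thesis
    unfolding has_dir_deriv_set_eq by (intro sets.countable_INT' Q) auto
qed

text \<open>Restricting \<open>u\<close> to a line in direction \<open>v\<close> gives a Lipschitz
  function of one variable. The exceptional set is Borel and null on every such line, hence
  null.\<close>

lemma AE_has_dir_deriv:
  fixes u :: "'a::euclidean_space \<Rightarrow> real"
  assumes lip: "L-lipschitz_on UNIV u"
  shows "AE x in lborel. \<exists>l. has_dir_deriv u v x l"
proof -
  have cont: "continuous_on UNIV u" using lip by (rule lipschitz_on_continuous_on)
  define A where "A = - {x. \<exists>l. has_dir_deriv u v x l}"
  have "A \<in> null_sets lborel"
  proof (rule null_set_if_null_on_lines[where v = v])
    show "A \<in> sets borel" unfolding A_def using borel_has_dir_deriv_set[OF cont] by auto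
    fix x
    have "(L * norm v)-lipschitz_on UNIV (\<lambda>t. u (x + t *\<^sub>R v))"
    proof (rule lipschitz_onI)
      fix s t :: real
      have "dist (u (x + s *\<^sub>R v)) (u (x + t *\<^sub>R v)) \<le> L * dist (x + s *\<^sub>R v) (x + t *\<^sub>R v)"
        by (rule lipschitz_onD[OF lip]) auto
      thus "dist (u (x + s *\<^sub>R v)) (u (x + t *\<^sub>R v)) \<le> L * norm v * dist s t"
        by (simp add: dist_norm mult.assoc mult.commute[of "norm v"] flip: scaleR_left_diff_distrib)
    qed (use lipschitz_on_nonneg[OF lip] in auto)
    hence "AE t in lborel. (\<lambda>t. u (x + t *\<^sub>R v)) differentiable (at t)"
      by (rule lipschitz_on_real_AE_differentiable)
    thus "AE t in lborel. x + t *\<^sub>R v \<notin> A"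
    proof eventually_elim
      case (elim t)
      then obtain l where "((\<lambda>t. u (x + t *\<^sub>R v)) has_real_derivative l) (at t)"
        by (auto simp: real_differentiable_def)
      hence "((\<lambda>s. u (x + (s + t) *\<^sub>R v)) has_real_derivative l) (at 0)"
        using DERIV_shift[of "\<lambda>t. u (x + t *\<^sub>R v)" l 0 t] by simp
      hence "has_dir_deriv u v (x + t *\<^sub>R v) l"
        unfolding has_dir_deriv_def by (simp add: algebra_simps)
      thus ?case by (auto simp: A_def)
    qed
  qed
  hence "AE x in lborel. x \<notin> A" by (rule AE_not_in)
  thus ?thesis by (simp add: A_def)
qed

section \<open>Additivity of directional derivatives almost everywhere\<close>

lemma countable_if_separated:
  fixes T :: "real set"
  assumes "d > 0" and sep: "\<And>s t. s \<in> T \<Longrightarrow> t \<in> T \<Longrightarrow> s \<noteq> t \<Longrightarrow> \<bar>t - s\<bar> \<ge> d"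
  shows "countable T"
proof (rule countableI')
  show "inj_on (\<lambda>t. to_nat \<lfloor>t / d\<rfloor>) T"
  proof (rule inj_onI, rule ccontr)
    fix s t assume st: "s \<in> T" "t \<in> T" "to_nat \<lfloor>s / d\<rfloor> = to_nat \<lfloor>t / d\<rfloor>" "s \<noteq> t"
    hence "\<lfloor>s / d\<rfloor> = \<lfloor>t / d\<rfloor>" by simp
    hence "\<bar>t / d - s / d\<bar> < 1" by linarith
    hence "\<bar>t - s\<bar> < d" using \<open>d > 0\<close> by (simp add: abs_divide flip: diff_divide_distrib)
    thus False using sep[OF st(1,2,4)] by simp
  qed
qed

text \<open>The argument of Nekvinda and Zajicek: two points of the bad set on a common line in
  direction \<open>v\<close> cannot be close to each other.\<close>
lemma null_set_nonadditive:
  fixes u :: "'a::euclidean_space \<Rightarrow> real"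
  assumes cont: "continuous_on UNIV u" and bad: "\<bar>y' - y - z\<bar> > 3 * e" and "d > 0"
  shows "approx_dir_deriv u v y e d \<inter> approx_dir_deriv u w z e d
           \<inter> approx_dir_deriv u (v + w) y' e d \<in> null_sets lborel" (is "?E \<in> _")
proof (rule null_set_if_null_on_lines[where v = v])
  show "?E \<in> sets borel"
    by (intro sets.Int borel_closed closed_approx_dir_deriv cont)
  fix x
  have "countable {t. x + t *\<^sub>R v \<in> ?E}"
  proof (rule countable_if_separated[OF \<open>d > 0\<close>], rule ccontr)
    fix s t assume st: "s \<in> {t. x + t *\<^sub>R v \<in> ?E}" "t \<in> {t. x + t *\<^sub>R v \<in> ?E}" "s \<noteq> t" "\<not> d \<le> \<bar>t - s\<bar>"
    define a where "a = x + s *\<^sub>R v"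
    define r where "r = t - s"
    have r: "\<bar>r\<bar> < d" "r \<noteq> 0" using st by (auto simp: r_def)
    have b: "x + t *\<^sub>R v = a + r *\<^sub>R v" by (simp add: a_def r_def algebra_simps)
    have E: "a \<in> ?E" "a + r *\<^sub>R v \<in> ?E" using st(1,2) unfolding b[symmetric] by (simp_all add: a_def)
    \<comment> \<open>The path from \<open>a\<close> to \<open>a + r *\<^sub>R (v + w)\<close> is
      split at \<open>a + r *\<^sub>R v\<close>. The second leg starts there, which is why this
      point must also lie in the bad set; the three errors add up to at most
      \<open>3 * e * \<bar>r\<bar>\<close>.\<close>
    have 1: "\<bar>u (a + r *\<^sub>R v) - u a - r * y\<bar> \<le> e * \<bar>r\<bar>"
      using E(1) r by (auto simp: approx_dir_deriv_def)
    have 2: "\<bar>u (a + r *\<^sub>R v + r *\<^sub>R w) - u (a + r *\<^sub>R v) - r * z\<bar> \<le> e * \<bar>r\<bar>"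
      using E(2) r by (auto simp: approx_dir_deriv_def)
    have 3: "\<bar>u (a + r *\<^sub>R v + r *\<^sub>R w) - u a - r * y'\<bar> \<le> e * \<bar>r\<bar>"
      using E(1) r by (auto simp: approx_dir_deriv_def scaleR_add_right add.assoc)
    have "\<bar>r * y' - r * y - r * z\<bar> \<le> 3 * (e * \<bar>r\<bar>)"
      using 1 2 3 by linarith
    moreover have "\<bar>r * y' - r * y - r * z\<bar> = \<bar>r\<bar> * \<bar>y' - y - z\<bar>"
      by (simp add: abs_mult flip: right_diff_distrib)
    ultimately have "\<bar>r\<bar> * \<bar>y' - y - z\<bar> \<le> \<bar>r\<bar> * (3 * e)"
      by (simp add: mult_ac)
    thus False using r bad by (simp add: mult_le_cancel_left)
  qed
  hence "{t. x + t *\<^sub>R v \<in> ?E} \<in> null_sets lborel" by (rule countable_imp_null_set_lborel)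
  hence "AE t in lborel. t \<notin> {t. x + t *\<^sub>R v \<in> ?E}" by (rule AE_not_in)
  thus "AE t in lborel. x + t *\<^sub>R v \<notin> ?E" by simp
qed

lemma AE_dir_deriv_add:
  fixes u :: "'a::euclidean_space \<Rightarrow> real"
  assumes cont: "continuous_on UNIV u"
  shows "AE x in lborel. \<forall>l1 l2 l3. has_dir_deriv u v x l1 \<and> has_dir_deriv u w x l2 \<and>
           has_dir_deriv u (v + w) x l3 \<longrightarrow> l3 = l1 + l2"
proof -
  define I :: "(real \<times> real \<times> real \<times> real \<times> real) set" where "I = \<rat> \<times> \<rat> \<times> \<rat> \<times> \<rat> \<times> \<rat>"
  have cI: "countable I" unfolding I_def by (intro countable_SIGMA countable_rat)
  have "AE x in lborel. \<forall>i\<in>I. case i of (y, z, y', e, d) \<Rightarrow> \<bar>y' - y - z\<bar> > 3 * e \<longrightarrow> d > 0 \<longrightarrow>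
          x \<notin> approx_dir_deriv u v y e d \<inter> approx_dir_deriv u w z e d \<inter> approx_dir_deriv u (v + w) y' e d"
    unfolding AE_ball_countable[OF cI]
  proof safe
    fix y z y' e d :: real
    show "AE x in lborel. \<bar>y' - y - z\<bar> > 3 * e \<longrightarrow> d > 0 \<longrightarrow>
          x \<notin> approx_dir_deriv u v y e d \<inter> approx_dir_deriv u w z e d \<inter> approx_dir_deriv u (v + w) y' e d"
      using AE_not_in[OF null_set_nonadditive[OF cont, of e y' y z d v w]]
      by (cases "\<bar>y' - y - z\<bar> > 3 * e \<and> d > 0") auto
  qed
  thus ?thesis
  proof eventually_elim
    case (elim x)
    show ?case
    proof (safe, rule ccontr)
      fix l1 l2 l3
      assume l: "has_dir_deriv u v x l1" "has_dir_deriv u w x l2" "has_dir_deriv u (v + w) x l3"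
        and "l3 \<noteq> l1 + l2"
      \<comment> \<open>Rounding three derivatives to rationals costs less than
        \<open>3 * e\<close>, and a defect above \<open>3 * e\<close> must remain for the null set
        lemma, so the defect has to exceed \<open>6 * e\<close>.\<close>
      hence pos: "0 < \<bar>l3 - l1 - l2\<bar> / 6" by auto
      obtain e where e: "e \<in> \<rat>" "0 < e" "e < \<bar>l3 - l1 - l2\<bar> / 6"
        using Rats_dense_in_real[OF pos] by auto
      have near: "\<exists>y\<in>\<rat>. \<bar>y - l\<bar> < e" for l
      proof -
        obtain y where "y \<in> \<rat>" "l < y" "y < l + e"
          using Rats_dense_in_real[of l "l + e"] e(2) by auto
        thus ?thesis by (intro bexI[of _ y]) auto
      qed
      obtain y where y: "y \<in> \<rat>" "\<bar>y - l1\<bar> < e" using near by blast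
      obtain z where z: "z \<in> \<rat>" "\<bar>z - l2\<bar> < e" using near by blast
      obtain y' where y': "y' \<in> \<rat>" "\<bar>y' - l3\<bar> < e" using near by blast
      obtain d1 where d1: "d1 \<in> \<rat>" "d1 > 0" "x \<in> approx_dir_deriv u v y e d1"
        using has_dir_deriv_imp_approx[OF l(1) y(2)] by blast
      obtain d2 where d2: "d2 \<in> \<rat>" "d2 > 0" "x \<in> approx_dir_deriv u w z e d2"
        using has_dir_deriv_imp_approx[OF l(2) z(2)] by blast
      obtain d3 where d3: "d3 \<in> \<rat>" "d3 > 0" "x \<in> approx_dir_deriv u (v + w) y' e d3"
        using has_dir_deriv_imp_approx[OF l(3) y'(2)] by blast
      define d where "d = min d1 (min d2 d3)"
      have d: "d \<in> \<rat>" "d > 0" using d1 d2 d3 by (auto simp: d_def min_def)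
      have le: "d \<le> d1" "d \<le> d2" "d \<le> d3" by (simp_all add: d_def)
      have "x \<in> approx_dir_deriv u v y e d"
        by (rule subsetD[OF approx_dir_deriv_mono[OF le(1)] d1(3)])
      moreover have "x \<in> approx_dir_deriv u w z e d"
        by (rule subsetD[OF approx_dir_deriv_mono[OF le(2)] d2(3)])
      moreover have "x \<in> approx_dir_deriv u (v + w) y' e d"
        by (rule subsetD[OF approx_dir_deriv_mono[OF le(3)] d3(3)])
      moreover have "\<bar>y' - y - z\<bar> > 3 * e"
      proof -
        have "\<bar>l3 - l1 - l2\<bar> \<le> \<bar>y' - y - z\<bar> + \<bar>y' - l3\<bar> + \<bar>y - l1\<bar> + \<bar>z - l2\<bar>" by linarith
        thus ?thesis using e(3) y(2) z(2) y'(2) by linarith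
      qed
      moreover have i: "(y, z, y', e, d) \<in> I" using y z y' e d by (auto simp: I_def)
      ultimately show False using bspec[OF elim i] d(2) by simp
    qed
  qed
qed

lemma has_dir_deriv_scaleR:
  assumes "has_dir_deriv u v x l"
  shows "has_dir_deriv u (c *\<^sub>R v) x (c * l)"
proof -
  have "((\<lambda>t. u (x + t *\<^sub>R v)) has_real_derivative l) (at (c * 0))"
    using assms by (simp add: has_dir_deriv_def)
  hence "((\<lambda>t. u (x + (c * t) *\<^sub>R v)) has_real_derivative l * c) (at 0)"
    by (rule DERIV_chain2) (auto intro!: derivative_eq_intros)
  thus ?thesis by (simp add: has_dir_deriv_def mult.commute)
qed

text \<open>The null set depends on the coefficients \<open>c\<close>, which are fixed outside, but
  not on \<open>D\<close>, which is quantified inside. Later only countably many coefficient vectors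
  are used.\<close>

lemma AE_dir_deriv_sum:
  fixes u :: "'a::euclidean_space \<Rightarrow> real"
  assumes lip: "L-lipschitz_on UNIV u" and "finite B"
  shows "AE x in lborel. \<forall>D. (\<forall>b\<in>B. has_dir_deriv u b x (D b)) \<longrightarrow>
           has_dir_deriv u (\<Sum>b\<in>B. c b *\<^sub>R b) x (\<Sum>b\<in>B. c b * D b)"
  using \<open>finite B\<close>
proof induction
  case empty
  show ?case by (auto simp: has_dir_deriv_def)
next
  case (insert b B)
  have cont: "continuous_on UNIV u" using lip by (rule lipschitz_on_continuous_on)
  show ?case
    using insert.IH AE_dir_deriv_add[OF cont, of "c b *\<^sub>R b" "\<Sum>b\<in>B. c b *\<^sub>R b"]
      AE_has_dir_deriv[OF lip, of "c b *\<^sub>R b + (\<Sum>b\<in>B. c b *\<^sub>R b)"]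
  proof eventually_elim
    case (elim x)
    show ?case
    proof safe
      fix D assume D: "\<forall>b\<in>insert b B. has_dir_deriv u b x (D b)"
      obtain l where l: "has_dir_deriv u (c b *\<^sub>R b + (\<Sum>b\<in>B. c b *\<^sub>R b)) x l" using elim(3) by blast
      have "has_dir_deriv u (\<Sum>b\<in>B. c b *\<^sub>R b) x (\<Sum>b\<in>B. c b * D b)"
        "has_dir_deriv u (c b *\<^sub>R b) x (c b * D b)"
        using elim(1) D by (auto intro: has_dir_deriv_scaleR)
      hence "l = c b * D b + (\<Sum>b\<in>B. c b * D b)" using elim(2) l by blast
      thus "has_dir_deriv u (\<Sum>b\<in>insert b B. c b *\<^sub>R b) x (\<Sum>b\<in>insert b B. c b * D b)"
        using l insert.hyps by simp
    qed
  qed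
qed

text \<open>By compactness of the unit sphere finitely many directions of \<open>S\<close> come
  within \<open>e\<close> of every unit vector, so one scale \<open>d\<close> serves them all. The
  Lipschitz bound on \<open>u\<close> and the norm of \<open>g\<close> control the passage to a
  nearby direction.\<close>

lemma has_derivative_if_dense_dir_derivs:
  fixes u :: "'a::euclidean_space \<Rightarrow> real"
  assumes lip: "L-lipschitz_on UNIV u"
    and dense: "\<And>X. open X \<Longrightarrow> X \<noteq> {} \<Longrightarrow> \<exists>d\<in>S. d \<in> X"
    and dir: "\<And>v. v \<in> S \<Longrightarrow> has_dir_deriv u v x (g \<bullet> v)"
  shows "(u has_derivative (\<lambda>h. g \<bullet> h)) (at x)"
  unfolding has_derivative_at_alt
proof safe
  show "bounded_linear (\<lambda>h. g \<bullet> h)" by (rule bounded_linear_inner_right)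
  fix r :: real assume "r > 0"
  have L: "L \<ge> 0" using lip by (rule lipschitz_on_nonneg)
  \<comment> \<open>The denominator collects three errors per unit length: \<open>e\<close> from the
    direction \<open>v\<close>, \<open>L * e\<close> from moving the point,
    \<open>norm g * e\<close> from moving the argument of the linear map.\<close>
  define e where "e = r / (1 + L + norm g)"
  have pos: "1 + L + norm g > 0" using L norm_ge_zero[of g] by linarith
  hence e: "e > 0" "e * (1 + L + norm g) = r" using \<open>r > 0\<close> by (simp_all add: e_def)
  have "sphere (0::'a) 1 \<subseteq> (\<Union>v\<in>S. ball v e)"
  proof
    fix z :: 'a
    obtain v where "v \<in> S" "v \<in> ball z e" using dense[of "ball z e"] e by auto
    thus "z \<in> (\<Union>v\<in>S. ball v e)" by (auto simp: dist_commute)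
  qed
  then obtain V where V: "V \<subseteq> S" "finite V" "sphere (0::'a) 1 \<subseteq> (\<Union>v\<in>V. ball v e)"
    using compactE_image[of "sphere (0::'a) 1" S "\<lambda>v. ball v e"] by (metis compact_sphere open_ball)
  have "\<forall>\<^sub>F t in at 0. \<forall>v\<in>V. \<bar>u (x + t *\<^sub>R v) - u x - t * (g \<bullet> v)\<bar> \<le> e * \<bar>t\<bar>"
  proof (rule eventually_ball_finite[OF V(2)], safe)
    fix v assume "v \<in> V"
    then obtain d where "d > 0" "\<forall>t. \<bar>t\<bar> < d \<longrightarrow> \<bar>u (x + t *\<^sub>R v) - u x - t * (g \<bullet> v)\<bar> \<le> e * \<bar>t\<bar>"
      using dir[of v] V(1) e(1) unfolding has_dir_deriv_iff by blast
    thus "\<forall>\<^sub>F t in at 0. \<bar>u (x + t *\<^sub>R v) - u x - t * (g \<bullet> v)\<bar> \<le> e * \<bar>t\<bar>"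
      unfolding eventually_at by (intro exI[of _ d]) auto
  qed
  then obtain d where d: "d > 0"
    "\<And>t v. t \<noteq> 0 \<Longrightarrow> \<bar>t\<bar> < d \<Longrightarrow> v \<in> V \<Longrightarrow> \<bar>u (x + t *\<^sub>R v) - u x - t * (g \<bullet> v)\<bar> \<le> e * \<bar>t\<bar>"
    unfolding eventually_at by auto
  show "\<exists>d>0. \<forall>y. norm (y - x) < d \<longrightarrow> norm (u y - u x - g \<bullet> (y - x)) \<le> r * norm (y - x)"
  proof (intro exI[of _ d] conjI d(1) allI impI)
    fix y assume y: "norm (y - x) < d"
    show "norm (u y - u x - g \<bullet> (y - x)) \<le> r * norm (y - x)"
    proof (cases "y = x")
      case False
      define t where "t = norm (y - x)"
      have t: "t > 0" "t < d" using False y by (auto simp: t_def)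
      define z where "z = (1 / t) *\<^sub>R (y - x)"
      have z: "norm z = 1" "y = x + t *\<^sub>R z" using t by (auto simp: z_def t_def)
      then obtain v where v: "v \<in> V" "dist v z < e" using V(3) by force
      have 1: "\<bar>u (x + t *\<^sub>R v) - u x - t * (g \<bullet> v)\<bar> \<le> e * t" using d(2)[of t v] t v by auto
      have "\<bar>u y - u (x + t *\<^sub>R v)\<bar> \<le> L * dist y (x + t *\<^sub>R v)"
        using lipschitz_onD[OF lip, of y "x + t *\<^sub>R v"] by (simp add: dist_real_def)
      also have "dist y (x + t *\<^sub>R v) = t * dist v z"
        using t by (simp add: z(2) dist_norm norm_minus_commute flip: scaleR_diff_right)
      also have "L * (t * dist v z) \<le> L * (t * e)"
        using v L t by (intro mult_left_mono) auto
      finally have 2: "\<bar>u y - u (x + t *\<^sub>R v)\<bar> \<le> L * (t * e)" .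
      have "\<bar>t * (g \<bullet> v) - g \<bullet> (y - x)\<bar> = t * \<bar>g \<bullet> (v - z)\<bar>"
        using t by (simp add: z(2) abs_mult inner_diff_right flip: right_diff_distrib)
      also have "\<dots> \<le> t * (norm g * norm (v - z))"
        using t by (intro mult_left_mono Cauchy_Schwarz_ineq2) auto
      also have "\<dots> \<le> t * (norm g * e)"
        using t v by (intro mult_left_mono) (auto simp: dist_norm)
      finally have 3: "\<bar>t * (g \<bullet> v) - g \<bullet> (y - x)\<bar> \<le> t * (norm g * e)" .
      have "\<bar>u y - u x - g \<bullet> (y - x)\<bar> \<le> e * t + L * (t * e) + t * (norm g * e)"
        using 1 2 3 by linarith
      also have "\<dots> = e * (1 + L + norm g) * t" by (simp add: algebra_simps)
      finally show ?thesis using e(2) by (simp add: t_def)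
    qed simp
  qed
qed

text \<open>A countable dense set of directions leaves a single null set. Outside it the partial
  derivatives assemble to \<open>g\<close>, and additivity makes \<open>g\<close> correct in every
  direction of the dense set.\<close>

theorem Rademacher:
  fixes u :: "'a::euclidean_space \<Rightarrow> real"
  assumes lip: "L-lipschitz_on UNIV u"
  shows "AE x in lborel. \<exists>g. (u has_derivative (\<lambda>h. g \<bullet> h)) (at x)"
proof -
  obtain S :: "'a set" where S: "countable S" "\<And>X. open X \<Longrightarrow> X \<noteq> {} \<Longrightarrow> \<exists>d\<in>S. d \<in> X"
    using countable_dense_exists by blast
  have "AE x in lborel. \<forall>v\<in>S. \<forall>D. (\<forall>b\<in>Basis. has_dir_deriv u b x (D b)) \<longrightarrow>
           has_dir_deriv u (\<Sum>b\<in>Basis. (v \<bullet> b) *\<^sub>R b) x (\<Sum>b\<in>Basis. (v \<bullet> b) * D b)"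
    unfolding AE_ball_countable[OF S(1)] by (intro ballI AE_dir_deriv_sum[OF lip]) auto
  moreover have "AE x in lborel. \<forall>b\<in>Basis. \<exists>l. has_dir_deriv u b x l"
    by (rule AE_finite_allI) (auto intro: AE_has_dir_deriv[OF lip])
  ultimately show ?thesis
  proof eventually_elim
    case (elim x)
    then obtain D where D: "\<And>b. b \<in> Basis \<Longrightarrow> has_dir_deriv u b x (D b)" by metis
    define g where "g = (\<Sum>b\<in>Basis. D b *\<^sub>R b)"
    have dir: "has_dir_deriv u v x (g \<bullet> v)" if "v \<in> S" for v
    proof -
      have "has_dir_deriv u (\<Sum>b\<in>Basis. (v \<bullet> b) *\<^sub>R b) x (\<Sum>b\<in>Basis. (v \<bullet> b) * D b)"
        using elim(1) that D by blast
      moreover have "g \<bullet> v = (\<Sum>b\<in>Basis. (v \<bullet> b) * D b)"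
        unfolding g_def inner_sum_left
        by (rule sum.cong) (simp_all add: inner_commute[of _ v])
      ultimately show ?thesis by (simp add: euclidean_representation)
    qed
    have "(u has_derivative (\<lambda>h. g \<bullet> h)) (at x)"
      by (rule has_derivative_if_dense_dir_derivs[OF lip S(2) dir])
    thus ?case ..
  qed
qed

section \<open>Gradients and ball averages\<close>

lemma grad_eqI:
  assumes "(v has_derivative (\<lambda>h. g \<bullet> h)) (at x)"
  shows "grad v x = g"
  unfolding grad_def
proof (rule some_equality)
  show "(v has_derivative (\<lambda>h. g \<bullet> h)) (at x)" by (rule assms)
  fix k assume "(v has_derivative (\<lambda>h. k \<bullet> h)) (at x)"
  hence "(\<lambda>h. k \<bullet> h) = (\<lambda>h. g \<bullet> h)" using has_derivative_unique assms by blast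
  hence "\<forall>h. k \<bullet> h = g \<bullet> h" by (rule fun_cong[THEN allI])
  thus "k = g" using vector_eq_rdot by blast
qed

lemma AE_has_derivative_grad:
  assumes "L-lipschitz_on UNIV u"
  shows "AE x in lborel. (u has_derivative (\<lambda>h. grad u x \<bullet> h)) (at x)"
  using Rademacher[OF assms] by eventually_elim (auto simp: grad_eqI)

lemma has_derivative_imp_has_dir_deriv:
  assumes "(v has_derivative (\<lambda>h. k \<bullet> h)) (at x)"
  shows "has_dir_deriv v w x (k \<bullet> w)"
proof -
  have "((\<lambda>t. x + t *\<^sub>R w) has_derivative (\<lambda>t. t *\<^sub>R w)) (at 0)"
    by (auto intro!: derivative_eq_intros)
  moreover have "(v has_derivative (\<lambda>h. k \<bullet> h)) (at (x + 0 *\<^sub>R w))" using assms by simp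
  ultimately have "((\<lambda>t. v (x + t *\<^sub>R w)) has_derivative (\<lambda>t. k \<bullet> (t *\<^sub>R w))) (at 0)"
    by (rule has_derivative_compose)
  thus ?thesis
    unfolding has_dir_deriv_def has_field_derivative_def by (simp add: mult.commute[of _ "k \<bullet> w"] mult_commute_abs)
qed

lemma has_derivative_imp_quotient_tendsto:
  fixes v :: "'a::euclidean_space \<Rightarrow> real"
  assumes "(v has_derivative (\<lambda>h. k \<bullet> h)) (at x)"
  shows "((\<lambda>t. (v (x + t *\<^sub>R w) - v x) / t) \<longlongrightarrow> k \<bullet> w) (at 0)"
  using has_derivative_imp_has_dir_deriv[OF assms, of w] by (simp add: has_dir_deriv_def DERIV_def)

text \<open>Comparing quotients along \<open>k\<close> itself gives
  \<open>\<bar>k \<bullet> k\<bar> \<le> \<bar>g \<bullet> k\<bar>\<close>, and Cauchy-Schwarz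
  finishes. It stands in for the chain rule with 1-Lipschitz outer functions such as truncation and
  absolute value.\<close>

lemma norm_grad_le_if_dominated:
  fixes u v :: "'a::euclidean_space \<Rightarrow> real"
  assumes u: "(u has_derivative (\<lambda>h. g \<bullet> h)) (at x)" and v: "(v has_derivative (\<lambda>h. k \<bullet> h)) (at x)"
    and dom: "\<And>y. \<bar>v y - v x\<bar> \<le> \<bar>u y - u x\<bar>"
  shows "norm k \<le> norm g"
proof -
  have "\<bar>k \<bullet> k\<bar> \<le> \<bar>g \<bullet> k\<bar>"
  proof (rule tendsto_le)
    show "((\<lambda>t. \<bar>(v (x + t *\<^sub>R k) - v x) / t\<bar>) \<longlongrightarrow> \<bar>k \<bullet> k\<bar>) (at 0)"
      by (rule tendsto_rabs[OF has_derivative_imp_quotient_tendsto[OF v]])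
    show "((\<lambda>t. \<bar>(u (x + t *\<^sub>R k) - u x) / t\<bar>) \<longlongrightarrow> \<bar>g \<bullet> k\<bar>) (at 0)"
      by (rule tendsto_rabs[OF has_derivative_imp_quotient_tendsto[OF u]])
    show "\<forall>\<^sub>F t in at 0. \<bar>(v (x + t *\<^sub>R k) - v x) / t\<bar> \<le> \<bar>(u (x + t *\<^sub>R k) - u x) / t\<bar>"
      by (intro always_eventually allI) (simp add: abs_divide dom divide_right_mono)
  qed simp
  also have "\<dots> \<le> norm g * norm k" by (rule Cauchy_Schwarz_ineq2)
  finally have "norm k * norm k \<le> norm g * norm k" by (simp add: power2_norm_eq_inner flip: power2_eq_square)
  thus ?thesis by (cases "k = 0") (auto simp: mult_le_cancel_right)
qed

lemma norm_grad_le_lipschitz: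
  fixes v :: "'a::euclidean_space \<Rightarrow> real"
  assumes "L-lipschitz_on UNIV v" and v: "(v has_derivative (\<lambda>h. k \<bullet> h)) (at x)"
  shows "norm k \<le> L"
proof -
  have "\<bar>k \<bullet> k\<bar> \<le> L * norm k"
  proof (rule tendsto_upperbound)
    show "((\<lambda>t. \<bar>(v (x + t *\<^sub>R k) - v x) / t\<bar>) \<longlongrightarrow> \<bar>k \<bullet> k\<bar>) (at 0)"
      by (rule tendsto_rabs[OF has_derivative_imp_quotient_tendsto[OF v]])
    have "\<bar>(v (x + t *\<^sub>R k) - v x) / t\<bar> \<le> L * norm k" if "t \<noteq> 0" for t
    proof -
      have "\<bar>v (x + t *\<^sub>R k) - v x\<bar> \<le> L * (\<bar>t\<bar> * norm k)"
        using lipschitz_onD[OF assms(1), of "x + t *\<^sub>R k" x] by (simp add: dist_norm)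
      thus ?thesis using that by (simp add: abs_divide divide_le_eq mult_ac)
    qed
    thus "\<forall>\<^sub>F t in at 0. \<bar>(v (x + t *\<^sub>R k) - v x) / t\<bar> \<le> L * norm k"
      by (auto simp: eventually_at_filter)
  qed simp
  hence "norm k * norm k \<le> L * norm k" by (simp add: power2_norm_eq_inner flip: power2_eq_square)
  thus ?thesis using lipschitz_on_nonneg[OF assms(1)] by (cases "k = 0") (auto simp: mult_le_cancel_right)
qed

text \<open>The coordinates of \<open>G\<close> are limits of difference quotients along the steps
  \<open>1 / real (Suc n)\<close>. Since \<open>lim\<close> is total and measurable,
  \<open>G\<close> is Borel everywhere, whatever \<open>grad\<close> chooses on the exceptional null
  set.\<close>

lemma borel_grad_representative:
  fixes v :: "'a::euclidean_space \<Rightarrow> real"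
  assumes lip: "L-lipschitz_on UNIV v"
  obtains G where "G \<in> borel_measurable borel" "AE x in lborel. G x = grad v x"
proof
  have "continuous_on UNIV v" using lip by (rule lipschitz_on_continuous_on)
  hence [measurable]: "v \<in> borel_measurable borel" by (rule borel_measurable_continuous_onI)
  define q where "q = (\<lambda>b n x. (v (x + (1 / real (Suc n)) *\<^sub>R b) - v x) / (1 / real (Suc n)))"
  define G where "G = (\<lambda>x. \<Sum>b\<in>Basis. lim (\<lambda>n. q b n x) *\<^sub>R (b::'a))"
  show "G \<in> borel_measurable borel" unfolding G_def q_def by measurable
  show "AE x in lborel. G x = grad v x"
    using AE_has_derivative_grad[OF lip]
  proof eventually_elim
    case (elim x)
    have "(\<lambda>n. q b n x) \<longlonglongrightarrow> grad v x \<bullet> b" for b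
    proof -
      have "filterlim (\<lambda>n. 1 / real (Suc n)) (at 0) sequentially"
        unfolding filterlim_at using LIMSEQ_Suc[OF lim_const_over_n] by auto
      from filterlim_compose[OF has_derivative_imp_quotient_tendsto[OF elim, of b] this]
      show ?thesis by (simp add: q_def)
    qed
    hence "G x = (\<Sum>b\<in>Basis. (grad v x \<bullet> b) *\<^sub>R b)" unfolding G_def
      by (intro sum.cong refl arg_cong2[where f = scaleR] limI)
    thus ?case by (simp add: euclidean_representation)
  qed
qed

lemma borel_measurable_grad:
  fixes v :: "'a::euclidean_space \<Rightarrow> real"
  assumes lip: "L-lipschitz_on UNIV v"
  shows "grad v \<in> borel_measurable lebesgue"
proof -
  obtain G where G: "G \<in> borel_measurable borel" "AE x in lborel. G x = grad v x"
    using borel_grad_representative[OF lip] by blast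
  show ?thesis
  proof (rule borel_measurable_AE[of G])
    show "G \<in> borel_measurable lebesgue" using G(1) by (intro measurable_completion) auto
    show "AE x in lebesgue. G x = grad v x" using G(2) by (rule AE_completion)
  qed
qed

section \<open>Averages over balls\<close>

definition ball_average :: "real \<Rightarrow> ('a::euclidean_space \<Rightarrow> 'b::euclidean_space) \<Rightarrow> 'a \<Rightarrow> 'b" where
  "ball_average r F x =
     (1 / measure lborel (cball (0::'a) r)) *\<^sub>R (LINT y|lborel. indicator (cball 0 r) y *\<^sub>R F (x + y))"

lemma integral_lborel_translate:
  fixes F :: "'a::euclidean_space \<Rightarrow> 'b::euclidean_space"
  assumes [measurable]: "F \<in> borel_measurable borel"
  shows "(LINT y|lborel. F (x + y)) = (LINT y|lborel. F y)"
proof -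
  have "(LINT y|lborel. F y) = (LINT y|distr lborel borel ((+) x). F y)"
    by (simp add: lborel_distr_plus)
  also have "\<dots> = (LINT y|lborel. F (x + y))"
    by (subst integral_distr) auto
  finally show ?thesis by simp
qed

lemma cball_in_borel [measurable]: "cball a r \<in> sets borel"
  by (intro borel_closed closed_cball)

lemma integrable_indicator_cball:
  fixes F :: "'a::euclidean_space \<Rightarrow> 'b::euclidean_space"
  assumes [measurable]: "F \<in> borel_measurable borel" and "\<And>y. norm (F y) \<le> c"
  shows "integrable lborel (\<lambda>y. indicator (cball a r) y *\<^sub>R F y)"
proof (rule Bochner_Integration.integrable_bound)
  show "integrable lborel (\<lambda>y::'a. indicator (cball a r) y *\<^sub>R c)"
    by (intro integrable_scaleR_left integrable_real_indicator emeasure_bounded_finite) auto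
  show "AE y in lborel. norm (indicator (cball a r) y *\<^sub>R F y) \<le> norm (indicator (cball a r) y *\<^sub>R c)"
    using assms(2) by (auto simp: indicator_def intro: order_trans[OF _ abs_ge_self])
qed auto

lemma measure_lborel_cball_pos:
  "r > 0 \<Longrightarrow> measure lborel (cball (a::'a::euclidean_space) r) > 0"
  using content_cball_pos[of r a] by simp

text \<open>After a translation the integrand is fixed and the ball moves. The indicators of the
  moving balls converge off the limiting sphere, a null set, so dominated convergence applies to any
  integrable \<open>F\<close>, continuous or not.\<close>

lemma continuous_ball_average:
  fixes F :: "'a::euclidean_space \<Rightarrow> 'b::euclidean_space"
  assumes F: "integrable lborel F"
  shows "continuous_on UNIV (ball_average r F)"
proof -
  have [measurable]: "F \<in> borel_measurable borel" using borel_measurable_integrable[OF F] by simp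
  define k where "k = (\<lambda>x. LINT z|lborel. indicator (cball x r) z *\<^sub>R F z)"
  have eq: "ball_average r F = (\<lambda>x. (1 / measure lborel (cball (0::'a) r)) *\<^sub>R k x)"
  proof
    fix x :: 'a
    have "k x = (LINT y|lborel. indicator (cball x r) (x + y) *\<^sub>R F (x + y))"
      unfolding k_def by (rule integral_lborel_translate[symmetric]) measurable
    also have "\<dots> = (LINT y|lborel. indicator (cball 0 r) y *\<^sub>R F (x + y))"
      by (intro Bochner_Integration.integral_cong) (auto simp: indicator_def dist_norm)
    finally show "ball_average r F x = (1 / measure lborel (cball (0::'a) r)) *\<^sub>R k x"
      by (simp add: ball_average_def)
  qed
  have "continuous (at x) k" for x
    unfolding continuous_at_sequentially o_def
  proof safe
    fix X assume X: "X \<longlonglongrightarrow> x"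
    have "AE z in lborel. z \<notin> sphere x r"
      by (intro AE_not_in) (use negligible_sphere[of x r] in \<open>auto simp: negligible_iff_null_sets null_sets_completion_iff\<close>)
    hence lim: "AE z in lborel. (\<lambda>i. indicator (cball (X i) r) z *\<^sub>R F z) \<longlonglongrightarrow> indicator (cball x r) z *\<^sub>R F z"
    proof eventually_elim
      case (elim z)
      have d: "(\<lambda>i. dist (X i) z) \<longlonglongrightarrow> dist x z" by (intro tendsto_intros X)
      have "\<forall>\<^sub>F i in sequentially. indicator (cball (X i) r) z *\<^sub>R F z = indicator (cball x r) z *\<^sub>R F z"
      proof (cases "dist x z < r")
        case True
        from order_tendstoD(2)[OF d True] show ?thesis
          by eventually_elim (use True in \<open>simp add: indicator_def\<close>)
      next
        case False
        hence False: "dist x z > r" using elim by auto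
        from order_tendstoD(1)[OF d False] show ?thesis
          by eventually_elim (use False in \<open>simp add: indicator_def\<close>)
      qed
      thus ?case by (rule tendsto_eventually)
    qed
    show "(\<lambda>i. k (X i)) \<longlonglongrightarrow> k x"
      unfolding k_def
      by (rule integral_dominated_convergence[OF _ _ integrable_norm[OF F] lim])
         (auto simp: indicator_def)
  qed
  hence "continuous_on UNIV k" by (simp add: continuous_at_imp_continuous_on)
  thus ?thesis unfolding eq by (intro continuous_intros)
qed

text \<open>Here the ball stays fixed and \<open>v\<close> is translated, so the derivative falls on
  \<open>v\<close>. The normalised remainder tends to 0 for almost every \<open>y\<close> and is
  bounded by \<open>2 * L\<close>, hence dominated convergence yields the derivative at every
  \<open>x\<close>.\<close>

lemma has_derivative_ball_average:
  fixes v :: "'a::euclidean_space \<Rightarrow> real"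
  assumes lip: "L-lipschitz_on UNIV v" and [measurable]: "G \<in> borel_measurable borel"
    and GL: "\<And>x. norm (G x) \<le> L" and der: "AE x in lborel. (v has_derivative (\<lambda>h. G x \<bullet> h)) (at x)"
    and bv: "\<And>x. \<bar>v x\<bar> \<le> M"
  shows "(ball_average r v has_derivative (\<lambda>h. ball_average r G x \<bullet> h)) (at x)"
  unfolding has_derivative_at
proof
  show "bounded_linear (\<lambda>h. ball_average r G x \<bullet> h)" by (rule bounded_linear_inner_right)
  have "continuous_on UNIV v" using lip by (rule lipschitz_on_continuous_on)
  hence [measurable]: "v \<in> borel_measurable borel" by (rule borel_measurable_continuous_onI)
  let ?B = "cball (0::'a) r" and ?m = "measure lborel (cball (0::'a) r)"
  show "(\<lambda>h. norm (ball_average r v (x + h) - ball_average r v x - ball_average r G x \<bullet> h) / norm h) \<midarrow>0\<rightarrow> 0"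
    unfolding tendsto_at_iff_sequentially o_def
  proof safe
    fix X assume X0: "\<forall>i. X i \<in> UNIV - {0}" and X: "X \<longlonglongrightarrow> (0::'a)"
    define S where "S = (\<lambda>i y. indicator ?B y *\<^sub>R ((v (x + X i + y) - v (x + y) - G (x + y) \<bullet> X i) / norm (X i)))"
    have "AE y in lborel. (v has_derivative (\<lambda>h. G (y + x) \<bullet> h)) (at (y + x))"
      by (rule AE_lborel_translate[OF der])
    hence lim: "AE y in lborel. (\<lambda>i. S i y) \<longlonglongrightarrow> 0"
    proof eventually_elim
      case (elim y)
      hence "(\<lambda>h. norm (v (y + x + h) - v (y + x) - G (y + x) \<bullet> h) / norm h) \<midarrow>0\<rightarrow> 0"
        by (simp add: has_derivative_at)
      hence "(\<lambda>i. norm (v (y + x + X i) - v (y + x) - G (y + x) \<bullet> X i) / norm (X i)) \<longlonglongrightarrow> 0"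
        using X0 X unfolding tendsto_at_iff_sequentially o_def by blast
      hence "(\<lambda>i. norm ((v (x + X i + y) - v (x + y) - G (x + y) \<bullet> X i) / norm (X i))) \<longlonglongrightarrow> 0"
        by (simp add: norm_divide algebra_simps)
      hence "(\<lambda>i. (v (x + X i + y) - v (x + y) - G (x + y) \<bullet> X i) / norm (X i)) \<longlonglongrightarrow> 0"
        by (rule tendsto_norm_zero_cancel)
      from tendsto_scaleR[OF tendsto_const this, of "indicator ?B y"]
      show ?case by (simp add: S_def)
    qed
    have bound: "norm (S i y) \<le> indicator ?B y *\<^sub>R (2 * L)" for i y
    proof -
      have n: "norm (X i) > 0" using X0 by auto
      have "\<bar>v (x + X i + y) - v (x + y)\<bar> \<le> L * norm (X i)"
        using lipschitz_onD[OF lip, of "x + X i + y" "x + y"] by (simp add: dist_norm algebra_simps)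
      moreover have "\<bar>G (x + y) \<bullet> X i\<bar> \<le> L * norm (X i)"
        using Cauchy_Schwarz_ineq2[of "G (x + y)" "X i"] mult_right_mono[OF GL[of "x + y"], of "norm (X i)"] by simp
      ultimately have "\<bar>v (x + X i + y) - v (x + y) - G (x + y) \<bullet> X i\<bar> \<le> 2 * L * norm (X i)" by linarith
      thus ?thesis using n by (auto simp: S_def indicator_def abs_divide divide_le_eq)
    qed
    have "(\<lambda>i. LINT y|lborel. S i y) \<longlonglongrightarrow> (LINT y|(lborel :: 'a measure). 0)"
    proof (rule integral_dominated_convergence[OF _ _ _ lim])
      show "integrable lborel (\<lambda>y::'a. indicator ?B y *\<^sub>R (2 * L))"
        by (rule integrable_indicator_cball[of _ "\<bar>2 * L\<bar>"]) auto
      show "S i \<in> borel_measurable lborel" for i unfolding S_def by measurable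
      show "AE y in lborel. norm (S i y) \<le> indicator ?B y *\<^sub>R (2 * L)" for i
        by (intro AE_I2 bound)
    qed auto
    hence "(\<lambda>i. \<bar>LINT y|lborel. S i y\<bar> * inverse ?m) \<longlonglongrightarrow> \<bar>0\<bar> * inverse ?m"
      by (intro tendsto_mult tendsto_rabs tendsto_const) simp
    moreover have "norm (ball_average r v (x + X i) - ball_average r v x - ball_average r G x \<bullet> X i) / norm (X i)
            = \<bar>LINT y|lborel. S i y\<bar> / ?m" for i
    proof -
      have n: "norm (X i) > 0" using X0 by auto
      have i1: "integrable lborel (\<lambda>y. indicator ?B y *\<^sub>R v (x' + y))" for x'
        by (rule integrable_indicator_cball[of _ M]) (auto simp: bv)
      have i2: "integrable lborel (\<lambda>y. indicator ?B y *\<^sub>R G (x + y))"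
        by (rule integrable_indicator_cball[of _ L]) (auto simp: GL)
      have "(LINT y|lborel. S i y) = (LINT y|lborel. (indicator ?B y *\<^sub>R v (x + X i + y) - indicator ?B y *\<^sub>R v (x + y)
               - (indicator ?B y *\<^sub>R G (x + y)) \<bullet> X i) / norm (X i))"
        unfolding S_def by (intro Bochner_Integration.integral_cong) (auto simp: indicator_def)
      also have "\<dots> = ((LINT y|lborel. indicator ?B y *\<^sub>R v (x + X i + y)) - (LINT y|lborel. indicator ?B y *\<^sub>R v (x + y))
               - (LINT y|lborel. indicator ?B y *\<^sub>R G (x + y)) \<bullet> X i) / norm (X i)"
        by (simp only: integral_divide_zero Bochner_Integration.integral_diff[OF Bochner_Integration.integrable_diff[OF i1 i1] integrable_inner_left[OF i2]]
            Bochner_Integration.integral_diff[OF i1 i1] integral_inner_left[OF i2])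
      finally have "(LINT y|lborel. S i y) / ?m =
          (ball_average r v (x + X i) - ball_average r v x - ball_average r G x \<bullet> X i) / norm (X i)"
        unfolding ball_average_def by (simp add: diff_divide_distrib mult.commute)
      hence "\<bar>(LINT y|lborel. S i y) / ?m\<bar> =
          \<bar>(ball_average r v (x + X i) - ball_average r v x - ball_average r G x \<bullet> X i) / norm (X i)\<bar>"
        by (rule arg_cong)
      thus ?thesis by (simp add: abs_divide)
    qed
    ultimately show "(\<lambda>i. norm (ball_average r v (x + X i) - ball_average r v x - ball_average r G x \<bullet> X i) / norm (X i)) \<longlonglongrightarrow> 0"
      by (simp add: divide_inverse)
  qed
qed

lemma ball_average_near:
  fixes v :: "'a::euclidean_space \<Rightarrow> real"
  assumes lip: "L-lipschitz_on UNIV v" and bv: "\<And>x. \<bar>v x\<bar> \<le> M" and r: "r > 0"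
  shows "\<bar>ball_average r v x - v x\<bar> \<le> L * r"
proof -
  have "continuous_on UNIV v" using lip by (rule lipschitz_on_continuous_on)
  hence [measurable]: "v \<in> borel_measurable borel" by (rule borel_measurable_continuous_onI)
  let ?B = "cball (0::'a) r" and ?m = "measure lborel (cball (0::'a) r)"
  have L: "L \<ge> 0" using lip by (rule lipschitz_on_nonneg)
  have m: "?m > 0" using r by (rule measure_lborel_cball_pos)
  have int_const: "(LINT y|lborel. indicator ?B y *\<^sub>R c) = ?m * c" for c :: real
    by (simp add: emeasure_lborel_cball_finite)
  have i1: "integrable lborel (\<lambda>y. indicator ?B y *\<^sub>R v (x + y))"
    by (rule integrable_indicator_cball[of _ M]) (auto simp: bv)
  have i2: "integrable lborel (\<lambda>y. indicator ?B y *\<^sub>R c)" for c :: real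
    by (rule integrable_indicator_cball[of _ "\<bar>c\<bar>"]) auto
  have "v (x + y) - v x \<le> L * r \<and> v x - v (x + y) \<le> L * r" if "y \<in> ?B" for y
  proof -
    have "\<bar>v (x + y) - v x\<bar> \<le> L * norm y"
      using lipschitz_onD[OF lip, of "x + y" x] by (simp add: dist_norm)
    also have "\<dots> \<le> L * r" using that L by (intro mult_left_mono) auto
    finally show ?thesis by auto
  qed
  hence le: "indicator ?B y *\<^sub>R v (x + y) \<le> indicator ?B y *\<^sub>R (v x + L * r)"
    "indicator ?B y *\<^sub>R (v x - L * r) \<le> indicator ?B y *\<^sub>R v (x + y)" for y
    by (force simp: indicator_def)+
  have "(LINT y|lborel. indicator ?B y *\<^sub>R v (x + y)) \<le> ?m * (v x + L * r)"
    "?m * (v x - L * r) \<le> (LINT y|lborel. indicator ?B y *\<^sub>R v (x + y))"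
    unfolding int_const[symmetric] by (intro integral_mono i1 i2 le)+
  thus ?thesis
    using m unfolding ball_average_def abs_le_iff by (simp add: field_simps)
qed

text \<open>The norm of an average is at most the average of the norms; exchanging the integrals,
  each translate of \<open>G\<close> contributes the same integral, and the weights sum to
  1.\<close>

lemma nn_integral_norm_ball_average_le:
  fixes G :: "'a::euclidean_space \<Rightarrow> 'b::euclidean_space"
  assumes [measurable]: "G \<in> borel_measurable borel" and GL: "\<And>x. norm (G x) \<le> L" and r: "r > 0"
  shows "(\<integral>\<^sup>+x. norm (ball_average r G x) \<partial>lborel) \<le> (\<integral>\<^sup>+x. norm (G x) \<partial>lborel)"
proof -
  let ?B = "cball (0::'a) r" and ?m = "measure lborel (cball (0::'a) r)"
  have m: "?m > 0" using r by (rule measure_lborel_cball_pos)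
  define F :: "'a \<Rightarrow> 'a \<Rightarrow> ennreal" where "F = (\<lambda>x y. indicator ?B y * ennreal (norm (G (x + y))))"
  have [measurable]: "case_prod F \<in> borel_measurable (lborel \<Otimes>\<^sub>M lborel)"
    unfolding F_def by measurable
  have "ennreal (norm (ball_average r G x)) \<le> ennreal (1 / ?m) * (\<integral>\<^sup>+y. F x y \<partial>lborel)" for x
  proof -
    have i: "integrable lborel (\<lambda>y. indicator ?B y *\<^sub>R norm (G (x + y)))"
      by (rule integrable_indicator_cball[of _ L]) (auto simp: GL)
    have "norm (LINT y|lborel. indicator ?B y *\<^sub>R G (x + y)) \<le> (LINT y|lborel. norm (indicator ?B y *\<^sub>R G (x + y)))"
      by (rule integral_norm_bound)
    also have "\<dots> = (LINT y|lborel. indicator ?B y *\<^sub>R norm (G (x + y)))"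
      by (intro Bochner_Integration.integral_cong) (auto simp: indicator_def)
    finally have "ennreal (norm (LINT y|lborel. indicator ?B y *\<^sub>R G (x + y))) \<le>
        ennreal (LINT y|lborel. indicator ?B y *\<^sub>R norm (G (x + y)))" by (rule ennreal_leI)
    also have "\<dots> = (\<integral>\<^sup>+y. ennreal (indicator ?B y *\<^sub>R norm (G (x + y))) \<partial>lborel)"
      by (rule nn_integral_eq_integral[symmetric, OF i]) (auto simp: indicator_def)
    also have "\<dots> = (\<integral>\<^sup>+y. F x y \<partial>lborel)"
      by (intro nn_integral_cong) (auto simp: F_def indicator_def)
    finally have "ennreal (1 / ?m) * ennreal (norm (LINT y|lborel. indicator ?B y *\<^sub>R G (x + y)))
        \<le> ennreal (1 / ?m) * (\<integral>\<^sup>+y. F x y \<partial>lborel)" by (rule mult_left_mono) auto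
    thus ?thesis using m by (simp add: ball_average_def ennreal_mult[symmetric])
  qed
  hence "(\<integral>\<^sup>+x. norm (ball_average r G x) \<partial>lborel) \<le> (\<integral>\<^sup>+x. ennreal (1 / ?m) * (\<integral>\<^sup>+y. F x y \<partial>lborel) \<partial>lborel)"
    by (rule nn_integral_mono)
  also have "\<dots> = ennreal (1 / ?m) * (\<integral>\<^sup>+x. (\<integral>\<^sup>+y. F x y \<partial>lborel) \<partial>lborel)"
    by (rule nn_integral_cmult) measurable
  also have "(\<integral>\<^sup>+x. (\<integral>\<^sup>+y. F x y \<partial>lborel) \<partial>lborel) = (\<integral>\<^sup>+y. (\<integral>\<^sup>+x. F x y \<partial>lborel) \<partial>lborel)"
    by (rule lborel_pair.Fubini'[symmetric]) measurable
  also have "\<dots> = (\<integral>\<^sup>+y. indicator ?B y * (\<integral>\<^sup>+x. norm (G x) \<partial>lborel) \<partial>lborel)"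
  proof (rule nn_integral_cong)
    fix y :: 'a
    have "(\<integral>\<^sup>+x. ennreal (norm (G (x + y))) \<partial>lborel) = (\<integral>\<^sup>+x. norm (G x) \<partial>lborel)"
      by (rule nn_integral_lborel_translate[where f = "\<lambda>x. ennreal (norm (G x))"]) measurable
    thus "(\<integral>\<^sup>+x. F x y \<partial>lborel) = indicator ?B y * (\<integral>\<^sup>+x. norm (G x) \<partial>lborel)"
      unfolding F_def by (subst nn_integral_cmult) auto
  qed
  also have "\<dots> = emeasure lborel ?B * (\<integral>\<^sup>+x. norm (G x) \<partial>lborel)"
    by (subst nn_integral_multc) auto
  also have "emeasure lborel ?B = ennreal ?m"
    using emeasure_lborel_cball_finite[of "0::'a" r] by (intro emeasure_eq_ennreal_measure) auto
  also have "ennreal (1 / ?m) * (ennreal ?m * (\<integral>\<^sup>+x. norm (G x) \<partial>lborel)) = (\<integral>\<^sup>+x. norm (G x) \<partial>lborel)"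
    using m by (simp add: mult.assoc[symmetric] ennreal_mult[symmetric])
  finally show ?thesis .
qed

section \<open>The Cheeger inequality for Lipschitz functions\<close>

lemma has_derivative_zero_if_zero_near:
  fixes v :: "'a::euclidean_space \<Rightarrow> real"
  assumes "open U" "x \<in> U" "\<And>y. y \<in> U \<Longrightarrow> v y = 0"
  shows "(v has_derivative (\<lambda>h. 0 \<bullet> h)) (at x)"
proof -
  have "((\<lambda>_::'a. 0::real) has_derivative (\<lambda>h. 0 \<bullet> h)) (at x)" unfolding inner_zero_left by (rule has_derivative_const)
  thus ?thesis
    by (rule has_derivative_transform_within_open[OF _ assms(1,2)]) (use assms(3) in simp)
qed

text \<open>Bridge from integrals of \<open>grad\<close>, which is only Lebesgue measurable, to
  Borel integrands on \<open>lborel\<close>, where Fubini and translation are available.\<close>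

lemma integral_lebesgue_cong_AE:
  fixes f h :: "'a::euclidean_space \<Rightarrow> real"
  assumes f: "f \<in> borel_measurable borel" and ae: "AE x in lborel. h x = f x"
  shows "integral\<^sup>L lebesgue h = integral\<^sup>L lborel f"
proof -
  have f': "f \<in> borel_measurable lebesgue" using f by (intro measurable_completion) auto
  have ae': "AE x in lebesgue. h x = f x" using ae by (rule AE_completion)
  have "h \<in> borel_measurable lebesgue"
    by (rule borel_measurable_AE[OF f']) (use ae' in eventually_elim, simp)
  hence "integral\<^sup>L lebesgue h = integral\<^sup>L lebesgue f" using f' ae' by (intro integral_cong_AE)
  also have "\<dots> = integral\<^sup>L lborel f" using f by (intro integral_completion) auto
  finally show ?thesis .
qed

lemma C1_0_approximation:
  fixes v :: "'a::euclidean_space \<Rightarrow> real"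
  assumes lip: "L-lipschitz_on UNIV v" and K: "compact K" "K \<subseteq> \<Omega>" and \<Omega>: "open \<Omega>"
    and supp: "\<And>x. x \<notin> K \<Longrightarrow> v x = 0" and e: "e > 0"
  obtains \<phi> where "\<phi> \<in> C1_0 \<Omega>" "\<And>x. \<bar>\<phi> x - v x\<bar> \<le> e"
    "(LINT x:\<Omega>|lebesgue. norm (grad \<phi> x)) \<le> (LINT x:\<Omega>|lebesgue. norm (grad v x))"
proof -
  have [measurable]: "\<Omega> \<in> sets borel" "K \<in> sets borel"
    using \<Omega> K(1) by (auto intro: borel_compact)
  have L: "L \<ge> 0" using lip by (rule lipschitz_on_nonneg)
  have cont: "continuous_on UNIV v" using lip by (rule lipschitz_on_continuous_on)
  obtain G0 where G0 [measurable]: "G0 \<in> borel_measurable borel" and G0_ae: "AE x in lborel. G0 x = grad v x"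
    using borel_grad_representative[OF lip] by blast
  \<comment> \<open>Correcting the representative on a null set makes the bound \<open>L\<close> and
    the vanishing off \<open>K\<close> hold at every point. The averages of \<open>G\<close> are
    then bounded and supported near \<open>K\<close>.\<close>
  define G where "G = (\<lambda>x. if x \<in> K \<and> norm (G0 x) \<le> L then G0 x else 0)"
  have [measurable]: "G \<in> borel_measurable borel" unfolding G_def by measurable
  have GL: "norm (G x) \<le> L" for x using L by (simp add: G_def)
  have GK: "G x = 0" if "x \<notin> K" for x using that by (simp add: G_def)
  have G_ae: "AE x in lborel. (v has_derivative (\<lambda>h. G x \<bullet> h)) (at x)"
    using G0_ae AE_has_derivative_grad[OF lip]
  proof eventually_elim
    case (elim x)
    show ?case
    proof (cases "x \<in> K")
      case True
      have "norm (grad v x) \<le> L" by (rule norm_grad_le_lipschitz[OF lip elim(2)])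
      hence "G x = grad v x" using elim True by (simp add: G_def)
      thus ?thesis using elim by simp
    next
      case False
      have "open (- K)" using K(1) compact_imp_closed by blast
      hence "(v has_derivative (\<lambda>h. 0 \<bullet> h)) (at x)"
        by (rule has_derivative_zero_if_zero_near) (use False supp in auto)
      thus ?thesis using GK[OF False] by simp
    qed
  qed
  have G_int: "integrable lborel G"
  proof -
    obtain R where R: "K \<subseteq> cball 0 R"
      using compact_imp_bounded[OF K(1)] by (metis bounded_subset_ballD ball_subset_cball order_trans)
    have "integrable lborel (\<lambda>y. indicator (cball 0 R) y *\<^sub>R G y)"
      by (rule integrable_indicator_cball[of _ L]) (auto simp: GL)
    moreover have "(\<lambda>y. indicator (cball 0 R) y *\<^sub>R G y) = G"
      using R GK by (force simp: indicator_def)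
    ultimately show ?thesis by simp
  qed
  obtain M where M: "\<And>x. \<bar>v x\<bar> \<le> M"
  proof -
    have "bounded (v ` K)"
      by (intro compact_imp_bounded compact_continuous_image continuous_on_subset[OF cont] K(1)) auto
    then obtain b where b: "b > 0" "\<And>x. x \<in> K \<Longrightarrow> \<bar>v x\<bar> \<le> b" by (auto simp: bounded_pos)
    have "\<bar>v x\<bar> \<le> b" for x using b supp[of x] by (cases "x \<in> K") auto
    thus ?thesis using that by blast
  qed
  have "closed (- \<Omega>)" "K \<inter> - \<Omega> = {}" using K(2) \<Omega> by auto
  from separate_compact_closed[OF K(1) this]
  obtain d where d: "d > 0" "\<And>x y. x \<in> K \<Longrightarrow> y \<in> - \<Omega> \<Longrightarrow> d \<le> dist x y"
    by blast
  \<comment> \<open>The first bound keeps the \<open>r\<close>-neighbourhood of \<open>K\<close>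
    inside \<open>\<Omega>\<close>; the second makes the displacement \<open>L * r\<close> at most
    \<open>e\<close>, with \<open>L + 1\<close> avoiding division by 0.\<close>
  define r where "r = min (d / 2) (e / (L + 1))"
  have r: "r > 0" "r < d" "L * r \<le> e"
  proof -
    show "r > 0" "r < d" using d e L by (auto simp: r_def min_less_iff_disj)
    have "L * r \<le> L * (e / (L + 1))" using L by (intro mult_left_mono) (auto simp: r_def)
    also have "\<dots> \<le> e" using L e by (simp add: field_simps)
    finally show "L * r \<le> e" .
  qed
  define \<phi> where "\<phi> = ball_average r v"
  define g where "g = ball_average r G"
  have der: "(\<phi> has_derivative (\<lambda>h. g x \<bullet> h)) (at x)" for x
    unfolding \<phi>_def g_def by (rule has_derivative_ball_average[OF lip _ GL G_ae M]) measurable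
  have g_cont: "continuous_on UNIV g"
    unfolding g_def by (rule continuous_ball_average[OF G_int])
  have grad: "grad \<phi> = g" by (rule ext) (rule grad_eqI[OF der])
  define K' where "K' = {x + y |x y. x \<in> K \<and> y \<in> cball 0 r}"
  have K': "compact K'" unfolding K'_def by (intro compact_sums K(1) compact_cball)
  have K'\<Omega>: "K' \<subseteq> \<Omega>"
  proof
    fix z assume "z \<in> K'"
    then obtain x y where z: "z = x + y" "x \<in> K" "norm y \<le> r" by (auto simp: K'_def)
    show "z \<in> \<Omega>"
    proof (rule ccontr)
      assume "z \<notin> \<Omega>"
      hence "d \<le> dist x z" using d(2) z by auto
      thus False using z r by (simp add: dist_norm)
    qed
  qed
  have zero: "\<phi> x = 0 \<and> g x = 0" if "x \<notin> K'" for x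
  proof -
    have "x + y \<notin> K" if "y \<in> cball 0 r" for y
    proof
      assume "x + y \<in> K"
      hence "(x + y) + (- y) \<in> K'" unfolding K'_def using that by (intro CollectI exI[of _ "x + y"] exI[of _ "- y"]) auto
      thus False using \<open>x \<notin> K'\<close> by simp
    qed
    hence "(\<lambda>y. indicator (cball 0 r) y *\<^sub>R v (x + y)) = (\<lambda>_. 0)"
      "(\<lambda>y. indicator (cball 0 r) y *\<^sub>R G (x + y)) = (\<lambda>_. 0)"
      using supp GK by (auto simp: indicator_def fun_eq_iff)
    thus ?thesis by (simp add: \<phi>_def g_def ball_average_def)
  qed
  have cl: "closure {x. \<phi> x \<noteq> 0} \<subseteq> K'"
    using zero K' by (intro closure_minimal compact_imp_closed) auto
  show ?thesis
  proof (rule that)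
    show "\<phi> \<in> C1_0 \<Omega>"
      unfolding C1_0_def
    proof (intro CollectI conjI exI[of _ g] allI der g_cont)
      show "closure {x. \<phi> x \<noteq> 0} \<subseteq> \<Omega>" using cl K'\<Omega> by blast
      show "compact (closure {x. \<phi> x \<noteq> 0})"
        using compact_Int_closed[OF K' closed_closure, of "{x. \<phi> x \<noteq> 0}"] cl by (simp add: Int_absorb1)
    qed
    show "\<bar>\<phi> x - v x\<bar> \<le> e" for x
      using ball_average_near[OF lip M r(1), of x] r(3) unfolding \<phi>_def by linarith
    have [measurable]: "g \<in> borel_measurable borel" using g_cont by (rule borel_measurable_continuous_onI)
    have le: "(\<integral>\<^sup>+x. ennreal (norm (g x)) \<partial>lborel) \<le> (\<integral>\<^sup>+x. ennreal (norm (G x)) \<partial>lborel)"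
      unfolding g_def by (rule nn_integral_norm_ball_average_le[OF _ GL r(1)]) measurable
    have fin: "(\<integral>\<^sup>+x. ennreal (norm (G x)) \<partial>lborel) < top"
      using G_int by (simp add: integrable_iff_bounded)
    have "(LINT x:\<Omega>|lebesgue. norm (grad \<phi> x)) = (LINT x|lborel. norm (g x))"
      unfolding set_lebesgue_integral_def
      by (rule integral_lebesgue_cong_AE) (use zero K'\<Omega> in \<open>auto simp: grad indicator_def\<close>)
    also have "\<dots> \<le> (LINT x|lborel. norm (G x))"
      using le fin by (subst (1 2) integral_eq_nn_integral) (auto intro: enn2real_mono)
    also have "(LINT x|lborel. norm (G x)) = (LINT x:\<Omega>|lebesgue. norm (grad v x))"
      unfolding set_lebesgue_integral_def
    proof (rule integral_lebesgue_cong_AE[symmetric])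
      show "AE x in lborel. indicator \<Omega> x *\<^sub>R norm (grad v x) = norm (G x)"
        using G_ae
      proof eventually_elim
        case (elim x)
        hence "grad v x = G x" by (rule grad_eqI)
        thus ?case using GK[of x] K(2) by (auto simp: indicator_def)
      qed
    qed measurable
    finally show "(LINT x:\<Omega>|lebesgue. norm (grad \<phi> x)) \<le> (LINT x:\<Omega>|lebesgue. norm (grad v x))" .
  qed
qed

section \<open>Integrability and relations between the function classes\<close>

lemma set_integrable_bounded_AE:
  fixes F :: "'a::euclidean_space \<Rightarrow> real"
  assumes \<Omega>: "open \<Omega>" "bounded \<Omega>" and F [measurable]: "F \<in> borel_measurable lebesgue"
    and bd: "AE x in lebesgue. \<bar>F x\<bar> \<le> c"
  shows "set_integrable lebesgue \<Omega> F"
  unfolding set_integrable_def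
proof (rule Bochner_Integration.integrable_bound)
  have [measurable]: "\<Omega> \<in> sets lebesgue" using \<Omega>(1) by (simp add: borel_open)
  have "emeasure lebesgue \<Omega> < \<infinity>"
    using emeasure_bounded_finite[OF \<Omega>(2)] \<Omega>(1) by (simp add: emeasure_completion borel_open)
  thus "integrable lebesgue (\<lambda>x. indicator \<Omega> x *\<^sub>R c)"
    by (intro integrable_scaleR_left integrable_real_indicator) auto
  show "AE x in lebesgue. norm (indicator \<Omega> x *\<^sub>R F x) \<le> norm (indicator \<Omega> x *\<^sub>R c)"
    using bd by eventually_elim (auto simp: indicator_def)
  show "(\<lambda>x. indicator \<Omega> x *\<^sub>R F x) \<in> borel_measurable lebesgue" by measurable
qed

lemma W1inf0_bounded:
  assumes "bounded \<Omega>" "u \<in> W1inf0 \<Omega>"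
  obtains c where "\<And>x. \<bar>u x\<bar> \<le> c"
proof -
  obtain L where lip: "L-lipschitz_on UNIV u" and z: "\<And>x. x \<notin> \<Omega> \<Longrightarrow> u x = 0"
    using assms(2) by (auto simp: W1inf0_def)
  have "bounded (u ` closure \<Omega>)"
    using assms(1) by (intro compact_imp_bounded compact_continuous_image
        continuous_on_subset[OF lipschitz_on_continuous_on[OF lip]]) auto
  then obtain b where b: "b > 0" "\<And>x. x \<in> closure \<Omega> \<Longrightarrow> \<bar>u x\<bar> \<le> b" by (auto simp: bounded_pos)
  have "\<bar>u x\<bar> \<le> b" for x using b z[of x] closure_subset[of \<Omega>] by (cases "x \<in> \<Omega>") auto
  thus ?thesis by (rule that)
qed

lemma borel_measurable_W1inf0:
  assumes "u \<in> W1inf0 \<Omega>"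
  shows "u \<in> borel_measurable borel"
  using assms lipschitz_on_continuous_on by (auto simp: W1inf0_def intro: borel_measurable_continuous_onI)

lemma set_integrable_W1inf0:
  assumes \<Omega>: "open \<Omega>" "bounded \<Omega>" and u: "u \<in> W1inf0 \<Omega>"
  shows "set_integrable lebesgue \<Omega> u" "set_integrable lebesgue \<Omega> (\<lambda>x. \<bar>u x\<bar>)"
    "set_integrable lebesgue \<Omega> (\<lambda>x. norm (grad u x))"
proof -
  obtain L where lip: "L-lipschitz_on UNIV u" using u by (auto simp: W1inf0_def)
  obtain c where c: "\<And>x. \<bar>u x\<bar> \<le> c" using W1inf0_bounded[OF \<Omega>(2) u] by blast
  have [measurable]: "u \<in> borel_measurable lebesgue"
    using borel_measurable_W1inf0[OF u] by (intro measurable_completion) auto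
  have [measurable]: "grad u \<in> borel_measurable lebesgue" by (rule borel_measurable_grad[OF lip])
  show "set_integrable lebesgue \<Omega> u" "set_integrable lebesgue \<Omega> (\<lambda>x. \<bar>u x\<bar>)"
    by (auto intro!: set_integrable_bounded_AE[OF \<Omega>, of _ c] simp: c)
  have "AE x in lborel. \<bar>norm (grad u x)\<bar> \<le> L"
    using AE_has_derivative_grad[OF lip] by eventually_elim (simp add: norm_grad_le_lipschitz[OF lip])
  hence "AE x in lebesgue. \<bar>norm (grad u x)\<bar> \<le> L" by (rule AE_completion)
  thus "set_integrable lebesgue \<Omega> (\<lambda>x. norm (grad u x))"
    by (intro set_integrable_bounded_AE[OF \<Omega>]) measurable
qed

text \<open>The continuous gradient is bounded on the compact support and vanishes off it, so it is
  bounded globally and the function is Lipschitz.\<close>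

lemma C1_0_subset_W1inf0:
  fixes \<phi> :: "'a::euclidean_space \<Rightarrow> real"
  assumes "\<phi> \<in> C1_0 \<Omega>"
  shows "\<phi> \<in> W1inf0 \<Omega>"
proof -
  obtain g where g: "continuous_on UNIV g" "\<And>x. (\<phi> has_derivative (\<lambda>h. g x \<bullet> h)) (at x)"
    and K0: "compact (closure {x. \<phi> x \<noteq> 0})" "closure {x. \<phi> x \<noteq> 0} \<subseteq> \<Omega>"
    using assms by (auto simp: C1_0_def)
  obtain K where K: "compact K" "K \<subseteq> \<Omega>" and z: "\<And>x. x \<notin> K \<Longrightarrow> \<phi> x = 0"
    using that[OF K0] closure_subset[of "{x. \<phi> x \<noteq> 0}"] by blast
  have "bounded (g ` K)"
    using K(1) by (intro compact_imp_bounded compact_continuous_image continuous_on_subset[OF g(1)]) auto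
  then obtain b where b: "b > 0" "\<And>x. x \<in> K \<Longrightarrow> norm (g x) \<le> b" by (auto simp: bounded_pos)
  have gb: "norm (g x) \<le> b" for x
  proof (cases "x \<in> K")
    case False
    have "open (- K)" using K(1) compact_imp_closed by blast
    hence "(\<phi> has_derivative (\<lambda>h. 0 \<bullet> h)) (at x)"
      by (rule has_derivative_zero_if_zero_near) (use False z in auto)
    hence "grad \<phi> x = 0" by (rule grad_eqI)
    moreover have "grad \<phi> x = g x" by (rule grad_eqI[OF g(2)])
    ultimately show ?thesis using b(1) by simp
  next
    case True
    thus ?thesis by (rule b(2))
  qed
  have "b-lipschitz_on UNIV \<phi>"
  proof (rule bounded_derivative_imp_lipschitz)
    show "(\<phi> has_derivative (\<lambda>h. g x \<bullet> h)) (at x within UNIV)" for x using g(2) by simp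
    show "onorm (\<lambda>h. g x \<bullet> h) \<le> b" for x
    proof (rule onorm_le)
      fix h
      have "\<bar>g x \<bullet> h\<bar> \<le> norm (g x) * norm h" by (rule Cauchy_Schwarz_ineq2)
      also have "\<dots> \<le> b * norm h" using gb by (intro mult_right_mono) auto
      finally show "norm (g x \<bullet> h) \<le> b * norm h" by simp
    qed
  qed (use b in auto)
  thus ?thesis using z K(2) by (auto simp: W1inf0_def)
qed

text \<open>The infimum of an empty set of reals carries no information, so a test function must be
  exhibited.\<close>

lemma C1_0_nontrivial:
  fixes \<Omega> :: "'a::euclidean_space set"
  assumes "domain \<Omega>"
  obtains \<phi> where "\<phi> \<in> C1_0 \<Omega>" "\<exists>x. \<phi> x \<noteq> 0"
proof -
  obtain a where "a \<in> \<Omega>" "open \<Omega>" using assms by (auto simp: domain_def)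
  then obtain s where s: "s > 0" "cball a s \<subseteq> \<Omega>" using open_contains_cball by blast
  \<comment> \<open>A tent of height \<open>s\<close> at \<open>a\<close>; an approximation within
    \<open>s / 2\<close> cannot vanish there.\<close>
  define v where "v = (\<lambda>x. max 0 (s - dist a x))"
  have "1-lipschitz_on UNIV v"
  proof (rule lipschitz_onI)
    fix x y :: 'a
    have "\<bar>dist a x - dist a y\<bar> \<le> dist x y" using dist_triangle[of a x y] dist_triangle[of a y x] by (simp add: dist_commute abs_le_iff)
    thus "dist (v x) (v y) \<le> 1 * dist x y" by (auto simp: v_def dist_real_def max_def abs_if split: if_splits)
  qed simp
  moreover have "v x = 0" if "x \<notin> cball a s" for x using that by (auto simp: v_def)
  ultimately obtain \<phi> where \<phi>: "\<phi> \<in> C1_0 \<Omega>" "\<And>x. \<bar>\<phi> x - v x\<bar> \<le> s / 2"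
    using C1_0_approximation[OF _ compact_cball s(2) \<open>open \<Omega>\<close>, of 1 v "s / 2"] s(1) by (metis half_gt_zero)
  have "v a = s" using s by (simp add: v_def)
  hence "\<phi> a \<noteq> 0" using \<phi>(2)[of a] s by auto
  thus ?thesis using that \<phi>(1) by blast
qed

lemma zero_if_integral_abs_zero:
  assumes \<Omega>: "open \<Omega>" "bounded \<Omega>" and u: "u \<in> W1inf0 \<Omega>"
    and int: "(LINT x:\<Omega>|lebesgue. \<bar>u x\<bar>) \<le> 0" and x: "x \<in> \<Omega>"
  shows "u x = 0"
proof -
  have "integrable lebesgue (\<lambda>x. indicator \<Omega> x *\<^sub>R \<bar>u x\<bar>)"
    using set_integrable_W1inf0(2)[OF \<Omega> u] by (simp add: set_integrable_def)
  moreover have "(LINT x|lebesgue. indicator \<Omega> x *\<^sub>R \<bar>u x\<bar>) = 0"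
    using int by (intro antisym integral_nonneg_AE) (auto simp: set_lebesgue_integral_def)
  ultimately have "AE x in lebesgue. indicator \<Omega> x *\<^sub>R \<bar>u x\<bar> = 0"
    by (subst (asm) integral_nonneg_eq_0_iff_AE) auto
  hence ae: "AE x \<in> \<Omega> in lebesgue. x \<in> {x. u x = 0}"
    by eventually_elim (auto simp: indicator_def)
  have "continuous_on UNIV u" using u lipschitz_on_continuous_on by (auto simp: W1inf0_def)
  hence "closed {x. u x = 0}" by (intro closed_Collect_eq) auto
  from mem_closed_if_AE_lebesgue_open[OF \<Omega>(1) this ae x] show ?thesis by simp
qed

lemma set_integral_nonneg_real:
  fixes F :: "'a \<Rightarrow> real"
  assumes "\<And>x. F x \<ge> 0"
  shows "(LINT x:A|M. F x) \<ge> 0"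
  unfolding set_lebesgue_integral_def by (rule integral_nonneg_AE) (use assms in simp)

section \<open>The Cheeger constant and its inequality\<close>

definition cheeger_quotients :: "'a::euclidean_space set \<Rightarrow> real set" where
  "cheeger_quotients \<Omega> = {(LINT x:\<Omega>|lebesgue. norm (grad \<phi> x)) / (LINT x:\<Omega>|lebesgue. \<bar>\<phi> x\<bar>)
                     | \<phi>. \<phi> \<in> C1_0 \<Omega> \<and> (\<exists>x. \<phi> x \<noteq> 0)}"

lemma cheeger_quotients_nonneg: "q \<in> cheeger_quotients \<Omega> \<Longrightarrow> q \<ge> 0"
  unfolding cheeger_quotients_def by (clarify, intro divide_nonneg_nonneg set_integral_nonneg_real) auto

lemma cheeger_quotients_nonempty:
  assumes "domain \<Omega>"
  shows "cheeger_quotients \<Omega> \<noteq> {}"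
proof -
  obtain \<phi> where "\<phi> \<in> C1_0 \<Omega>" "\<exists>x. \<phi> x \<noteq> 0" by (rule C1_0_nontrivial[OF assms])
  hence "(LINT x:\<Omega>|lebesgue. norm (grad \<phi> x)) / (LINT x:\<Omega>|lebesgue. \<bar>\<phi> x\<bar>) \<in> cheeger_quotients \<Omega>"
    unfolding cheeger_quotients_def by (intro CollectI exI[of _ \<phi>]) simp
  thus ?thesis by (metis empty_iff)
qed

lemma cheeger_eq: "cheeger \<Omega> = Inf (cheeger_quotients \<Omega>)"
  by (simp add: cheeger_def cheeger_quotients_def)

lemma cheeger_nonneg:
  assumes "domain \<Omega>"
  shows "cheeger \<Omega> \<ge> 0"
  unfolding cheeger_eq
  by (rule cInf_greatest[OF cheeger_quotients_nonempty[OF assms] cheeger_quotients_nonneg])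

text \<open>The product form also covers a vanishing denominator, where the quotient itself would be
  meaningless.\<close>

lemma cheeger_le:
  assumes "\<phi> \<in> C1_0 \<Omega>"
  shows "cheeger \<Omega> * (LINT x:\<Omega>|lebesgue. \<bar>\<phi> x\<bar>) \<le> (LINT x:\<Omega>|lebesgue. norm (grad \<phi> x))"
proof (cases "(LINT x:\<Omega>|lebesgue. \<bar>\<phi> x\<bar>) = 0")
  case True
  moreover have "0 \<le> (LINT x:\<Omega>|lebesgue. norm (grad \<phi> x))"
    by (rule set_integral_nonneg_real) simp
  ultimately show ?thesis by simp
next
  case False
  have "0 \<le> (LINT x:\<Omega>|lebesgue. \<bar>\<phi> x\<bar>)" by (rule set_integral_nonneg_real) simp
  hence pos: "0 < (LINT x:\<Omega>|lebesgue. \<bar>\<phi> x\<bar>)" using False by simp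
  have "\<exists>x. \<phi> x \<noteq> 0"
    by (rule ccontr) (use False in \<open>simp add: set_lebesgue_integral_def\<close>)
  with assms have "(LINT x:\<Omega>|lebesgue. norm (grad \<phi> x)) / (LINT x:\<Omega>|lebesgue. \<bar>\<phi> x\<bar>) \<in> cheeger_quotients \<Omega>"
    unfolding cheeger_quotients_def by (intro CollectI exI[of _ \<phi>]) simp
  hence "cheeger \<Omega> \<le> (LINT x:\<Omega>|lebesgue. norm (grad \<phi> x)) / (LINT x:\<Omega>|lebesgue. \<bar>\<phi> x\<bar>)"
    unfolding cheeger_eq by (intro cInf_lower bdd_belowI[of _ 0] cheeger_quotients_nonneg)
  thus ?thesis using pos by (simp add: le_divide_eq)
qed

text \<open>Since \<open>u\<close> is continuous and vanishes outside \<open>\<Omega>\<close>, the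
  set where \<open>\<bar>u x\<bar> \<ge> e\<close> is compact in \<open>\<Omega>\<close>. Removing
  the part of \<open>u\<close> below level \<open>e\<close> therefore gives a compactly supported
  function that the averaging lemma can treat, and neither operation increases the gradient
  integral.\<close>

lemma cheeger_inequality_W1inf0:
  fixes u :: "'a::euclidean_space \<Rightarrow> real"
  assumes dom: "domain \<Omega>" and bdd: "bounded \<Omega>" and u: "u \<in> W1inf0 \<Omega>"
  shows "cheeger \<Omega> * (LINT x:\<Omega>|lebesgue. \<bar>u x\<bar>) \<le> (LINT x:\<Omega>|lebesgue. norm (grad u x))"
proof -
  have \<Omega>: "open \<Omega>" "bounded \<Omega>" using dom bdd by (auto simp: domain_def)
  have [measurable]: "\<Omega> \<in> sets lebesgue" using \<Omega>(1) by (simp add: borel_open)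
  have finm: "emeasure lebesgue \<Omega> < \<infinity>"
    using emeasure_bounded_finite[OF \<Omega>(2)] \<Omega>(1) by (simp add: emeasure_completion borel_open)
  obtain L where lip: "L-lipschitz_on UNIV u" and z: "\<And>x. x \<notin> \<Omega> \<Longrightarrow> u x = 0"
    using u by (auto simp: W1inf0_def)
  have cont: "continuous_on UNIV u" using lip by (rule lipschitz_on_continuous_on)
  let ?h = "cheeger \<Omega>" and ?m = "measure lebesgue \<Omega>"
  have h: "?h \<ge> 0" by (rule cheeger_nonneg[OF dom])
  \<comment> \<open>Truncation and averaging each change values by at most \<open>e\<close>, which
    accounts for \<open>2 * e\<close> times the measure of \<open>\<Omega>\<close>.\<close>
  have key: "?h * ((LINT x:\<Omega>|lebesgue. \<bar>u x\<bar>) - 2 * e * ?m) \<le> (LINT x:\<Omega>|lebesgue. norm (grad u x))"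
    if e: "e > 0" for e
  proof -
    text \<open>Truncation moves the support of \<open>u\<close> into a compact subset of \<open>\<Omega>\<close>.\<close>
    define w where "w = (\<lambda>x. u x - max (- e) (min e (u x)))"
    have trunc: "\<bar>w x - w y\<bar> \<le> \<bar>u x - u y\<bar>" for x y
      by (auto simp: w_def max_def min_def)
    define K where "K = closure \<Omega> \<inter> {x. \<bar>u x\<bar> \<ge> e}"
    have "closed {x. \<bar>u x\<bar> \<ge> e}" by (intro closed_Collect_le continuous_intros cont)
    hence K: "compact K" unfolding K_def using \<Omega>(2) by (intro compact_Int_closed) auto
    have K\<Omega>: "K \<subseteq> \<Omega>" using z e by (fastforce simp: K_def)
    have wK: "w x = 0" if "x \<notin> K" for x
    proof -
      have "\<bar>u x\<bar> < e"
        using that z[of x] e closure_subset[of \<Omega>] by (cases "x \<in> \<Omega>") (auto simp: K_def)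
      thus ?thesis by (simp add: w_def)
    qed
    have wlip: "L-lipschitz_on UNIV w"
    proof (rule lipschitz_onI)
      fix x y
      show "dist (w x) (w y) \<le> L * dist x y"
        using trunc[of x y] lipschitz_onD[OF lip, of x y] by (simp add: dist_real_def)
    qed (rule lipschitz_on_nonneg[OF lip])
    have wW: "w \<in> W1inf0 \<Omega>" using wlip wK K\<Omega> by (auto simp: W1inf0_def)
    obtain \<phi> where \<phi>: "\<phi> \<in> C1_0 \<Omega>" "\<And>x. \<bar>\<phi> x - w x\<bar> \<le> e"
      "(LINT x:\<Omega>|lebesgue. norm (grad \<phi> x)) \<le> (LINT x:\<Omega>|lebesgue. norm (grad w x))"
      using C1_0_approximation[OF wlip K K\<Omega> \<Omega>(1) wK e] by blast
    have \<phi>W: "\<phi> \<in> W1inf0 \<Omega>" by (rule C1_0_subset_W1inf0[OF \<phi>(1)])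
    have const: "set_integrable lebesgue \<Omega> (\<lambda>x. 2 * e)"
      by (rule set_integrable_bounded_AE[OF \<Omega>, of _ "2 * e"]) (use e in auto)
    have "(LINT x:\<Omega>|lebesgue. \<bar>u x\<bar>) - 2 * e * ?m = (LINT x:\<Omega>|lebesgue. \<bar>u x\<bar> - 2 * e)"
      unfolding set_integral_diff(2)[OF set_integrable_W1inf0(2)[OF \<Omega> u] const]
      using finm by (subst set_integral_const) auto
    also have "\<dots> \<le> (LINT x:\<Omega>|lebesgue. \<bar>\<phi> x\<bar>)"
    proof (rule set_integral_mono)
      show "set_integrable lebesgue \<Omega> (\<lambda>x. \<bar>u x\<bar> - 2 * e)"
        by (intro set_integral_diff(1) set_integrable_W1inf0(2)[OF \<Omega> u] const)
      show "set_integrable lebesgue \<Omega> (\<lambda>x. \<bar>\<phi> x\<bar>)" by (rule set_integrable_W1inf0(2)[OF \<Omega> \<phi>W])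
      fix x
      have "\<bar>u x - w x\<bar> \<le> e" using e by (auto simp: w_def max_def min_def)
      thus "\<bar>u x\<bar> - 2 * e \<le> \<bar>\<phi> x\<bar>" using \<phi>(2)[of x] by linarith
    qed
    finally have "?h * ((LINT x:\<Omega>|lebesgue. \<bar>u x\<bar>) - 2 * e * ?m) \<le> ?h * (LINT x:\<Omega>|lebesgue. \<bar>\<phi> x\<bar>)"
      using h by (rule mult_left_mono)
    also have "\<dots> \<le> (LINT x:\<Omega>|lebesgue. norm (grad \<phi> x))" by (rule cheeger_le[OF \<phi>(1)])
    also have "\<dots> \<le> (LINT x:\<Omega>|lebesgue. norm (grad w x))" by (rule \<phi>(3))
    also have "\<dots> \<le> (LINT x:\<Omega>|lebesgue. norm (grad u x))"
      unfolding set_lebesgue_integral_def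
    proof (rule integral_mono_AE)
      show "integrable lebesgue (\<lambda>x. indicator \<Omega> x *\<^sub>R norm (grad w x))"
        "integrable lebesgue (\<lambda>x. indicator \<Omega> x *\<^sub>R norm (grad u x))"
        using set_integrable_W1inf0(3)[OF \<Omega> wW] set_integrable_W1inf0(3)[OF \<Omega> u] by (simp_all add: set_integrable_def)
      have "AE x in lborel. indicator \<Omega> x *\<^sub>R norm (grad w x) \<le> indicator \<Omega> x *\<^sub>R norm (grad u x)"
        using AE_has_derivative_grad[OF lip] AE_has_derivative_grad[OF wlip]
      proof eventually_elim
        case (elim x)
        have "norm (grad w x) \<le> norm (grad u x)"
          by (rule norm_grad_le_if_dominated[OF elim trunc])
        thus ?case by (simp add: indicator_def)
      qed
      thus "AE x in lebesgue. indicator \<Omega> x *\<^sub>R norm (grad w x) \<le> indicator \<Omega> x *\<^sub>R norm (grad u x)"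
        by (rule AE_completion)
    qed
    finally show ?thesis .
  qed
  show ?thesis
  proof (rule field_le_epsilon)
    fix d :: real assume d: "d > 0"
    define e where "e = d / (2 * (?h * ?m + 1))"
    have hm: "?h * ?m \<ge> 0" using h by simp
    hence e: "e > 0" using d by (simp add: e_def)
    have "2 * e = d / (?h * ?m + 1)" using hm by (simp add: e_def field_simps)
    hence "2 * e * (?h * ?m) = d * (?h * ?m / (?h * ?m + 1))" by simp
    also have "\<dots> \<le> d * 1" using hm d by (intro mult_left_mono) (auto simp: divide_le_eq)
    finally have "2 * e * (?h * ?m) \<le> d" by simp
    thus "?h * (LINT x:\<Omega>|lebesgue. \<bar>u x\<bar>) \<le> (LINT x:\<Omega>|lebesgue. norm (grad u x)) + d"
      using key[OF e] by (simp add: right_diff_distrib mult_ac)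
  qed
qed

section \<open>Minimizers\<close>

text \<open>Two mean values: \<open>f s\<close> equals \<open>f' x * s\<close> for some
  \<open>x\<close> strictly between 0 and \<open>s\<close>, and \<open>f' x\<close> exceeds
  \<open>f' 0\<close> because \<open>f''\<close> is positive at an intermediate point. Continuity of
  \<open>f'\<close> at 0 lets the second one start at the end point.\<close>

lemma convex_slope_at_zero_less:
  fixes f f' f'' :: "real \<Rightarrow> real"
  assumes f: "\<forall>s\<ge>0. (f has_real_derivative f' s) (at s within {0..})"
    and f': "continuous_on {0..} f'" "\<And>s. s > 0 \<Longrightarrow> (f' has_real_derivative f'' s) (at s)"
    and f'': "\<And>s. s > 0 \<Longrightarrow> f'' s > 0"
    and "f 0 = 0" "s > 0"
  shows "f' 0 * s < f s"
proof -
  have "\<exists>x\<in>{0<..<s}. f s - f 0 = f' x * (s - 0)"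
  proof (rule mvt_simple[OF \<open>s > 0\<close>])
    fix x assume "0 \<le> x" "x \<le> s"
    hence "(f has_real_derivative f' x) (at x within {0..s})"
      using f by (auto intro: DERIV_subset)
    thus "(f has_derivative (*) (f' x)) (at x within {0..s})"
      by (simp add: has_field_derivative_def)
  qed
  then obtain x where x: "0 < x" "x < s" "f s = f' x * s" using \<open>f 0 = 0\<close> by auto
  have "\<exists>l z. 0 < z \<and> z < x \<and> (f' has_real_derivative l) (at z) \<and> f' x - f' 0 = (x - 0) * l"
    by (rule MVT[OF x(1)])
       (use f' in \<open>auto intro: continuous_on_subset simp: real_differentiable_def\<close>)
  then obtain l z where z: "0 < z" "(f' has_real_derivative l) (at z)" "f' x - f' 0 = x * l" by auto
  have "l = f'' z" using z f'(2) DERIV_unique by blast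
  hence "f' x - f' 0 > 0" using z x f'' by simp
  thus ?thesis using x(3) \<open>s > 0\<close> by simp
qed

lemma slope_at_zero_upper:
  fixes f :: "real \<Rightarrow> real"
  assumes "(f has_real_derivative D) (at 0 within {0..})" "f 0 = 0" "c > D"
  obtains r where "r > 0" "\<And>s. 0 \<le> s \<Longrightarrow> s \<le> r \<Longrightarrow> f s \<le> c * s"
proof -
  have "((\<lambda>y. f y / y) \<longlongrightarrow> D) (at 0 within {0..})"
    using assms(1,2) by (simp add: has_field_derivative_iff)
  hence "\<forall>\<^sub>F y in at 0 within {0..}. f y / y < c" using assms(3) by (rule order_tendstoD)
  then obtain d where d: "d > 0" "\<And>y. y \<ge> 0 \<Longrightarrow> y \<noteq> 0 \<Longrightarrow> \<bar>y\<bar> < d \<Longrightarrow> f y / y < c"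
    unfolding eventually_at by (auto simp: dist_real_def)
  show ?thesis
  proof (rule that[of "d / 2"])
    fix s assume s: "0 \<le> s" "s \<le> d / 2"
    show "f s \<le> c * s"
    proof (cases "s = 0")
      case False
      hence "f s / s < c" using d s by auto
      thus ?thesis using s False by (simp add: divide_less_eq)
    qed (use assms(2) in simp)
  qed (use d in simp)
qed

lemma set_integrable_f_grad:
  assumes \<Omega>: "open \<Omega>" "bounded \<Omega>" and u: "u \<in> W1inf0 \<Omega>"
    and f: "continuous_on {0..} f" "mono_on {0..} f" "f 0 = (0::real)"
  shows "set_integrable lebesgue \<Omega> (\<lambda>x. f (norm (grad u x)))"
proof -
  obtain L where lip: "L-lipschitz_on UNIV u" using u by (auto simp: W1inf0_def)
  have [measurable]: "grad u \<in> borel_measurable lebesgue" by (rule borel_measurable_grad[OF lip])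
  \<comment> \<open>Continuity of \<open>f\<close> is known only on the half line; composing with
    \<open>max 0\<close> extends it continuously without changing values at norms.\<close>
  have "continuous_on UNIV (\<lambda>s. f (max 0 s))"
    by (rule continuous_on_compose2[OF f(1)]) (auto intro!: continuous_intros)
  hence "(\<lambda>s. f (max 0 s)) \<in> borel_measurable borel" by (rule borel_measurable_continuous_onI)
  hence "(\<lambda>x. f (max 0 (norm (grad u x)))) \<in> borel_measurable lebesgue"
    by (rule measurable_compose[rotated]) measurable
  hence meas: "(\<lambda>x. f (norm (grad u x))) \<in> borel_measurable lebesgue" by (simp add: max_absorb2)
  have "AE x in lborel. \<bar>f (norm (grad u x))\<bar> \<le> f L"
    using AE_has_derivative_grad[OF lip]
  proof eventually_elim
    case (elim x)
    have n: "norm (grad u x) \<le> L" by (rule norm_grad_le_lipschitz[OF lip elim])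
    have "f 0 \<le> f (norm (grad u x))" by (rule mono_onD[OF f(2)]) auto
    moreover have "f (norm (grad u x)) \<le> f L"
      by (rule mono_onD[OF f(2)]) (use n lipschitz_on_nonneg[OF lip] in auto)
    ultimately show ?case using f(3) by simp
  qed
  thus ?thesis by (intro set_integrable_bounded_AE[OF \<Omega> meas] AE_completion)
qed

lemma I_fun_eq:
  assumes \<Omega>: "open \<Omega>" "bounded \<Omega>" and u: "u \<in> W1inf0 \<Omega>"
    and f: "continuous_on {0..} f" "mono_on {0..} f" "f 0 = 0"
  shows "I_fun f \<Omega> u = (LINT x:\<Omega>|lebesgue. f (norm (grad u x))) - (LINT x:\<Omega>|lebesgue. u x)"
  unfolding I_fun_def
  by (rule set_integral_diff(2)[OF set_integrable_f_grad[OF \<Omega> u f] set_integrable_W1inf0(1)[OF \<Omega> u]])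

lemma I_fun_zero:
  fixes \<Omega> :: "'a::euclidean_space set"
  assumes "f 0 = 0"
  shows "I_fun f \<Omega> (\<lambda>_. 0) = 0"
proof -
  have "((\<lambda>_::'a. 0::real) has_derivative (\<lambda>h. 0 \<bullet> h)) (at x)" for x
    by (rule has_derivative_zero_if_zero_near[of UNIV]) auto
  hence "grad (\<lambda>_::'a. 0::real) x = 0" for x by (rule grad_eqI)
  thus ?thesis using assms by (simp add: I_fun_def set_lebesgue_integral_def)
qed

text \<open>For a fixed \<open>c > D\<close> a small enough \<open>t\<close> brings the slopes of
  \<open>t * \<bar>\<phi> x\<bar>\<close> into the range where \<open>f s \<le> c * s\<close>. The
  comparison is then linear in \<open>t\<close>, which cancels, and only \<open>c\<close> is sent to
  \<open>D\<close>; no limit under the integral occurs.\<close>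

lemma integral_abs_le_if_I_fun_nonneg:
  fixes \<Omega> :: "'a::euclidean_space set"
  assumes \<Omega>: "open \<Omega>" "bounded \<Omega>" and \<phi>: "\<phi> \<in> W1inf0 \<Omega>"
    and f: "continuous_on {0..} f" "mono_on {0..} f" "f 0 = 0"
    and D: "(f has_real_derivative D) (at 0 within {0..})" "D > 0"
    and nonneg: "\<And>v. v \<in> W1inf0 \<Omega> \<Longrightarrow> 0 \<le> I_fun f \<Omega> v"
  shows "(LINT x:\<Omega>|lebesgue. \<bar>\<phi> x\<bar>) \<le> D * (LINT x:\<Omega>|lebesgue. norm (grad \<phi> x))" (is "?J \<le> D * ?P")
proof -
  obtain L where lip: "L-lipschitz_on UNIV \<phi>" and z: "\<And>x. x \<notin> \<Omega> \<Longrightarrow> \<phi> x = 0"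
    using \<phi> by (auto simp: W1inf0_def)
  have L: "L \<ge> 0" using lip by (rule lipschitz_on_nonneg)
  have key: "?J \<le> c * ?P" if c: "c > D" for c
  proof -
    obtain r where r: "r > 0" "\<And>s. 0 \<le> s \<Longrightarrow> s \<le> r \<Longrightarrow> f s \<le> c * s"
      using slope_at_zero_upper[OF D(1) f(3) c] by blast
    \<comment> \<open>Chosen so that the Lipschitz constant \<open>t * L\<close> of the competitor
      does not exceed \<open>r\<close>.\<close>
    define t where "t = r / (L + 1)"
    have t: "t > 0" using r L by (simp add: t_def)
    have tL: "t * L \<le> r" using r L by (simp add: t_def field_simps)
    define v where "v = (\<lambda>x. t * \<bar>\<phi> x\<bar>)"
    \<comment> \<open>The gradient of \<open>w\<close> is a multiple of that of
      \<open>\<phi>\<close>, and \<open>w\<close> dominates the increments of \<open>v\<close>; this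
      bounds the gradient of \<open>v\<close> without differentiating the absolute value.\<close>
    define w where "w = (\<lambda>x. t * \<phi> x)"
    have vw: "\<bar>v y - v x\<bar> \<le> \<bar>w y - w x\<bar>" for x y
    proof -
      have "t * \<bar>\<bar>\<phi> y\<bar> - \<bar>\<phi> x\<bar>\<bar> \<le> t * \<bar>\<phi> y - \<phi> x\<bar>" using t by (intro mult_left_mono) auto
      thus ?thesis using t by (simp add: v_def w_def abs_mult flip: right_diff_distrib)
    qed
    have wlip: "(t * L)-lipschitz_on UNIV w"
      unfolding w_def using lipschitz_on_cmult_real[OF lip, of t] t by simp
    have vlip: "(t * L)-lipschitz_on UNIV v"
    proof (rule lipschitz_onI)
      fix x y
      show "dist (v x) (v y) \<le> t * L * dist x y"
        using vw[of x y] lipschitz_onD[OF wlip, of x y] by (simp add: dist_real_def)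
    qed (use t L in simp)
    have v: "v \<in> W1inf0 \<Omega>" using vlip z by (auto simp: W1inf0_def v_def)
    have "0 \<le> (LINT x:\<Omega>|lebesgue. f (norm (grad v x))) - (LINT x:\<Omega>|lebesgue. v x)"
      using nonneg[OF v] unfolding I_fun_eq[OF \<Omega> v f] .
    moreover have "(LINT x:\<Omega>|lebesgue. v x) = t * ?J" unfolding v_def by simp
    moreover have "(LINT x:\<Omega>|lebesgue. f (norm (grad v x))) \<le> (LINT x:\<Omega>|lebesgue. c * t * norm (grad \<phi> x))"
      unfolding set_lebesgue_integral_def
    proof (rule integral_mono_AE)
      show "integrable lebesgue (\<lambda>x. indicator \<Omega> x *\<^sub>R f (norm (grad v x)))"
        using set_integrable_f_grad[OF \<Omega> v f] by (simp add: set_integrable_def)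
      have "set_integrable lebesgue \<Omega> (\<lambda>x. c * t * norm (grad \<phi> x))"
        by (intro set_integrable_mult_right set_integrable_W1inf0(3)[OF \<Omega> \<phi>])
      thus "integrable lebesgue (\<lambda>x. indicator \<Omega> x *\<^sub>R (c * t * norm (grad \<phi> x)))"
        by (simp add: set_integrable_def)
      have "AE x in lborel. indicator \<Omega> x *\<^sub>R f (norm (grad v x)) \<le> indicator \<Omega> x *\<^sub>R (c * t * norm (grad \<phi> x))"
        using AE_has_derivative_grad[OF lip] AE_has_derivative_grad[OF vlip]
      proof eventually_elim
        case (elim x)
        have "(w has_derivative (\<lambda>h. t * (grad \<phi> x \<bullet> h))) (at x)"
          unfolding w_def by (rule has_derivative_mult_right[OF elim(1)])
        hence w: "(w has_derivative (\<lambda>h. (t *\<^sub>R grad \<phi> x) \<bullet> h)) (at x)" by simp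
        have "norm (grad v x) \<le> norm (t *\<^sub>R grad \<phi> x)"
          by (rule norm_grad_le_if_dominated[OF w elim(2) vw])
        hence n: "norm (grad v x) \<le> t * norm (grad \<phi> x)" using t by simp
        have "norm (grad v x) \<le> t * L" by (rule norm_grad_le_lipschitz[OF vlip elim(2)])
        hence "f (norm (grad v x)) \<le> c * norm (grad v x)" using r(2) tL by simp
        also have "\<dots> \<le> c * (t * norm (grad \<phi> x))" using n c D(2) by (intro mult_left_mono) auto
        finally show ?case by (simp add: indicator_def mult.assoc)
      qed
      thus "AE x in lebesgue. indicator \<Omega> x *\<^sub>R f (norm (grad v x)) \<le> indicator \<Omega> x *\<^sub>R (c * t * norm (grad \<phi> x))"
        by (rule AE_completion)
    qed
    moreover have "(LINT x:\<Omega>|lebesgue. c * t * norm (grad \<phi> x)) = t * (c * ?P)" by simp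
    ultimately have "t * ?J \<le> t * (c * ?P)" by linarith
    thus ?thesis using t by (simp add: mult_le_cancel_left)
  qed
  have P: "?P \<ge> 0" by (rule set_integral_nonneg_real) simp
  show ?thesis
  proof (rule field_le_epsilon)
    fix e :: real assume e: "e > 0"
    have "?J \<le> (D + e / (?P + 1)) * ?P" using e P by (intro key) simp
    also have "\<dots> = D * ?P + e * (?P / (?P + 1))" by (simp add: distrib_right)
    also have "e * (?P / (?P + 1)) \<le> e * 1" using e P by (intro mult_left_mono) (auto simp: divide_le_eq)
    finally show "?J \<le> D * ?P + e" by simp
  qed
qed

theorem theorem3p2:
  fixes \<Omega> :: "'a::euclidean_space set"
    and f f' :: "real \<Rightarrow> real"
    and u :: "'a \<Rightarrow> real"
  assumes dom: "domain \<Omega>" and bdd: "bounded \<Omega>"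
    \<comment> \<open>(f1)\<close>
    and f_C1: "\<forall>s\<ge>0. (f has_real_derivative f' s) (at s within {0..})"
    and f'_cont: "continuous_on {0..} f'"
    and f_convex: "convex_on {0..} f"
    and f_mono: "mono_on {0..} f"
    and f0: "f 0 = 0"
    and f_superlin: "filterlim (\<lambda>s. f s / s) at_top at_top"
    \<comment> \<open>(f3)\<close>
    and f'0: "f' 0 > 0"
    and f_C2a: "\<exists>\<alpha> f''. 0 < \<alpha> \<and> \<alpha> < 1 \<and>
                 (\<forall>s>0. (f' has_real_derivative f'' s) (at s)) \<and>
                 (\<forall>K. compact K \<and> K \<subseteq> {0<..} \<longrightarrow>
                     (\<exists>C. \<forall>s\<in>K. \<forall>t\<in>K. \<bar>f'' s - f'' t\<bar> \<le> C * \<bar>s - t\<bar> powr \<alpha>)) \<and>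
                 (\<forall>s>0. f'' s > 0)"
    \<comment> \<open>u is the solution of the minimization problem\<close>
    and u_W: "u \<in> W1inf0 \<Omega>"
    and u_min: "\<forall>v\<in>W1inf0 \<Omega>. I_fun f \<Omega> u \<le> I_fun f \<Omega> v"
  shows "(\<forall>x\<in>\<Omega>. u x = 0) \<longleftrightarrow> f' 0 * cheeger \<Omega> \<ge> 1"
proof
  have \<Omega>: "open \<Omega>" "bounded \<Omega>" using dom bdd by (auto simp: domain_def)
  have f_cont: "continuous_on {0..} f"
    using f_C1 by (intro DERIV_continuous_on) auto
  note f = f_cont f_mono f0
  have D: "(f has_real_derivative f' 0) (at 0 within {0..})" using f_C1 by simp
  {
    assume "\<forall>x\<in>\<Omega>. u x = 0"
    hence "u = (\<lambda>_. 0)" using u_W by (auto simp: W1inf0_def fun_eq_iff)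
    hence nonneg: "0 \<le> I_fun f \<Omega> v" if "v \<in> W1inf0 \<Omega>" for v
      using u_min that I_fun_zero[of f \<Omega>, OF f0] by auto
    have "1 / f' 0 \<le> cheeger \<Omega>"
      unfolding cheeger_eq
    proof (rule cInf_greatest[OF cheeger_quotients_nonempty[OF dom]])
      fix q assume "q \<in> cheeger_quotients \<Omega>"
      then obtain \<phi> x where \<phi>: "\<phi> \<in> C1_0 \<Omega>" "\<phi> x \<noteq> 0"
        and q: "q = (LINT x:\<Omega>|lebesgue. norm (grad \<phi> x)) / (LINT x:\<Omega>|lebesgue. \<bar>\<phi> x\<bar>)"
        unfolding cheeger_quotients_def by blast
      have W: "\<phi> \<in> W1inf0 \<Omega>" by (rule C1_0_subset_W1inf0[OF \<phi>(1)])
      have x: "x \<in> \<Omega>" using W \<phi>(2) by (auto simp: W1inf0_def)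
      \<comment> \<open>By continuity a test function that is nonzero at one point has a positive
        integral, so the quotient is genuine.\<close>
      have pos: "(LINT x:\<Omega>|lebesgue. \<bar>\<phi> x\<bar>) > 0"
        using zero_if_integral_abs_zero[OF \<Omega> W _ x] \<phi>(2) by force
      have "(LINT x:\<Omega>|lebesgue. \<bar>\<phi> x\<bar>) \<le> f' 0 * (LINT x:\<Omega>|lebesgue. norm (grad \<phi> x))"
        by (rule integral_abs_le_if_I_fun_nonneg[OF \<Omega> W f D f'0 nonneg])
      thus "1 / f' 0 \<le> q" unfolding q using pos f'0 by (simp add: field_simps)
    qed
    thus "f' 0 * cheeger \<Omega> \<ge> 1" using f'0 by (simp add: divide_le_eq mult.commute)
  }
  assume h: "f' 0 * cheeger \<Omega> \<ge> 1"
  obtain f'' where f'': "\<And>s. s > 0 \<Longrightarrow> (f' has_real_derivative f'' s) (at s)" "\<And>s. s > 0 \<Longrightarrow> f'' s > 0"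
    using f_C2a by blast
  have strict: "f' 0 * s < f s" if "s > 0" for s
    by (rule convex_slope_at_zero_less[OF f_C1 f'_cont f'' f0 that])
  have below: "f' 0 * s \<le> f s" if "s \<ge> 0" for s
    using strict[of s] that f0 by (cases "s = 0") auto
  let ?J = "LINT x:\<Omega>|lebesgue. \<bar>u x\<bar>" and ?P = "LINT x:\<Omega>|lebesgue. norm (grad u x)"
    and ?F = "LINT x:\<Omega>|lebesgue. f (norm (grad u x))" and ?U = "LINT x:\<Omega>|lebesgue. u x"
  have J: "?J \<ge> 0" by (rule set_integral_nonneg_real) simp
  have "?J \<le> f' 0 * cheeger \<Omega> * ?J" using mult_right_mono[OF h J] by simp
  also have "\<dots> \<le> f' 0 * ?P"
    using cheeger_inequality_W1inf0[OF dom bdd u_W] f'0 by (simp add: mult.assoc mult_left_mono)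
  finally have JP: "?J \<le> f' 0 * ?P" .
  have "(\<lambda>_. 0) \<in> W1inf0 \<Omega>" by (auto simp: W1inf0_def intro!: exI[of _ 0] lipschitz_onI)
  hence "I_fun f \<Omega> u \<le> 0" using u_min I_fun_zero[of f \<Omega>, OF f0] by metis
  hence FU: "?F \<le> ?U" unfolding I_fun_eq[OF \<Omega> u_W f] by simp
  have UJ: "?U \<le> ?J"
    by (rule set_integral_mono[OF set_integrable_W1inf0(1,2)[OF \<Omega> u_W]]) auto
  have iP: "set_integrable lebesgue \<Omega> (\<lambda>x. f' 0 * norm (grad u x))"
    by (intro set_integrable_mult_right set_integrable_W1inf0(3)[OF \<Omega> u_W])
  have iF: "set_integrable lebesgue \<Omega> (\<lambda>x. f (norm (grad u x)))"
    by (rule set_integrable_f_grad[OF \<Omega> u_W f])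
  \<comment> \<open>The pointwise gap between \<open>f\<close> and its tangent at 0 is nonnegative,
    while the chain of inequalities makes its integral nonpositive; it vanishes almost everywhere,
    and strictness then forces the gradient to be 0.\<close>
  define k where "k = (\<lambda>x. indicator \<Omega> x *\<^sub>R (f (norm (grad u x)) - f' 0 * norm (grad u x)))"
  have k: "integrable lebesgue k"
    using set_integral_diff(1)[OF iF iP] by (simp add: k_def set_integrable_def)
  have k0: "k x \<ge> 0" for x using below[of "norm (grad u x)"] by (simp add: k_def)
  have "integral\<^sup>L lebesgue k = ?F - f' 0 * ?P"
    using set_integral_diff(2)[OF iF iP] by (simp add: k_def set_lebesgue_integral_def)
  also have "\<dots> \<le> 0" using FU UJ JP by simp
  finally have "integral\<^sup>L lebesgue k = 0" using k0 by (intro antisym integral_nonneg_AE) auto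
  hence "AE x in lebesgue. k x = 0"
    using integral_nonneg_eq_0_iff_AE[OF k] k0 by auto
  hence "AE x in lebesgue. indicator \<Omega> x *\<^sub>R norm (grad u x) = 0"
  proof eventually_elim
    case (elim x)
    have "norm (grad u x) = 0" if "x \<in> \<Omega>"
      using strict[of "norm (grad u x)"] elim that by (force simp: k_def)
    thus ?case by (simp add: indicator_def)
  qed
  hence "?P = 0" unfolding set_lebesgue_integral_def by (rule integral_eq_zero_AE)
  \<comment> \<open>The Cheeger inequality, already contained in \<open>JP\<close>, turns the
    vanishing gradient integral into a vanishing integral of \<open>\<bar>u x\<bar>\<close>, so no
    separate argument about functions with zero gradient is made.\<close>
  hence "?J \<le> 0" using JP by simp
  thus "\<forall>x\<in>\<Omega>. u x = 0" using zero_if_integral_abs_zero[OF \<Omega> u_W] by blast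
qed

end
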